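(* Let $F$ be Thompson's group and let $\mu$ be a probability measure on $F$ that has finite first moment and whose support generates $F$ as a semigroup. Then the Poisson boundary of $(F,\mu)$ is non-trivial.
   Context: Thompson's group $F$ is the group of orientation-preserving piecewise linear self-homeomorphisms of $[0,1]$ with finitely many break points, all break points being dyadic rationals and all slopes being powers of $2$; it is finitely generated. A measure $\mu$ on a finitely generated group has finite first moment if $\sum_g|g|\mu(g)<\infty$, where $|\cdot|$ is the word length for some (equivalently, any) finite generating set. Poisson boundary: for a probability measure $\mu$ on a countable group $H$, consider the random walk $x_0=e$, $x_{n+1}=y_nx_n$ with i.i.d. increments $y_n$ of law $\mu$, and let $P$ be the associated Markov measure on the trajectory space $H^{\mathbb{N}}$. Two trajectories $(x_i)$ and $(x'_i)$ are equivalent if there exist $i_0\in\mathbb{N}$ and $k\in\mathbb{Z}$ such that $x_i=x'_{i+k}$ for all $i>i_0$. The Poisson boundary of $(H,\mu)$ is the quotient of $(H^{\mathbb{N}},P)$ by the measurable hull of this equivalence relation; it is non-trivial if it is not a single point up to null sets. When $\operatorname{supp}(\mu)$ generates $H$ as a semigroup, non-triviality is equivalent to the existence of a non-constant bounded function $f$ on $H$ with $f(g)=\sum_{h\in H}f(hg)\mu(h)$ for all $g\in H$. *)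

theory Defs
  imports
    "HOL-Algebra.Bij"
    "HOL-Algebra.Generated_Groups"
    "HOL-Probability.Probability"
begin

section \<open>Thompson's group F\<close>

definition dyadic :: "real set" where
  "dyadic = {of_int m / 2 ^ n | (m::int) (n::nat). True}"

text \<open>
  The finite set \<open>B\<close> contains the break points of \<open>f\<close>; between consecutive points
  of \<open>B\<close> the map is affine, with a power of 2 as slope. Elements of \<^term>\<open>Bij {0..1}\<close>
  are extensional, so each homeomorphism of the interval is represented by exactly one function.
\<close>

definition thompson_homeo :: "(real \<Rightarrow> real) \<Rightarrow> bool" where
  "thompson_homeo f \<longleftrightarrow>
     f \<in> Bij {0..1} \<and>
     (\<exists>g. homeomorphism {0..1} {0..1} f g) \<and>
     strict_mono_on {0..1} f \<and>
     (\<exists>B. finite B \<and> B \<subseteq> dyadic \<and>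
        (\<forall>a b. 0 \<le> a \<and> a < b \<and> b \<le> 1 \<and> {a<..<b} \<inter> B = {} \<longrightarrow>
           (\<exists>k::int. \<forall>x\<in>{a..b}. f x = f a + 2 powi k * (x - a))))"

definition thompson_F :: "(real \<Rightarrow> real) monoid" where
  "thompson_F = (BijGroup {0..1})\<lparr>carrier := {f. thompson_homeo f}\<rparr>"


section \<open>Measures on a countable group\<close>

text \<open>
  A measure on a countable group \<open>G\<close> is a measure whose \<open>\<sigma>\<close>-algebra is the power set of
  \<^term>\<open>carrier G\<close>.
\<close>

definition supp :: "'a measure \<Rightarrow> 'a set" where
  "supp \<mu> = {g \<in> space \<mu>. measure \<mu> {g} > 0}"

inductive_set semigroup_generate :: "('a, 'b) monoid_scheme \<Rightarrow> 'a set \<Rightarrow> 'a set"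
  for G and A where
  incl: "a \<in> A \<Longrightarrow> a \<in> semigroup_generate G A"
| mult: "g \<in> semigroup_generate G A \<Longrightarrow> h \<in> semigroup_generate G A \<Longrightarrow>
           g \<otimes>\<^bsub>G\<^esub> h \<in> semigroup_generate G A"

definition word_length :: "('a, 'b) monoid_scheme \<Rightarrow> 'a set \<Rightarrow> 'a \<Rightarrow> nat" where
  "word_length G S g =
     (LEAST n. \<exists>w. length w = n \<and> set w \<subseteq> S \<union> m_inv G ` S \<and> foldr (\<otimes>\<^bsub>G\<^esub>) w \<one>\<^bsub>G\<^esub> = g)"

definition finite_first_moment :: "('a, 'b) monoid_scheme \<Rightarrow> 'a measure \<Rightarrow> bool" where
  "finite_first_moment G \<mu> \<longleftrightarrow>
     (\<exists>S. finite S \<and> S \<subseteq> carrier G \<and> generate G S = carrier G \<and>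
        (\<lambda>g. real (word_length G S g) * measure \<mu> {g}) summable_on carrier G)"


section \<open>The random walk\<close>

primrec walk :: "('a, 'b) monoid_scheme \<Rightarrow> (nat \<Rightarrow> 'a) \<Rightarrow> nat \<Rightarrow> 'a" where
  "walk G y 0 = \<one>\<^bsub>G\<^esub>"
| "walk G y (Suc n) = y n \<otimes>\<^bsub>G\<^esub> walk G y n"

definition trajectory_measure ::
    "('a, 'b) monoid_scheme \<Rightarrow> 'a measure \<Rightarrow> (nat \<Rightarrow> 'a) measure" where
  "trajectory_measure G \<mu> =
     distr (Pi\<^sub>M UNIV (\<lambda>_. \<mu>)) (Pi\<^sub>M UNIV (\<lambda>_. count_space (carrier G))) (walk G)"

definition trajectory_rel :: "('a, 'b) monoid_scheme \<Rightarrow> ((nat \<Rightarrow> 'a) \<times> (nat \<Rightarrow> 'a)) set" where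
  "trajectory_rel G =
     {(x, x'). x \<in> UNIV \<rightarrow> carrier G \<and> x' \<in> UNIV \<rightarrow> carrier G \<and>
        (\<exists>(i\<^sub>0::nat) (k::int). \<forall>i>i\<^sub>0. 0 \<le> int i + k \<and> x i = x' (nat (int i + k)))}"


section \<open>Measurable hulls, quotients and the Poisson boundary\<close>

text \<open>
  These are the notions of Rokhlin's theory of measurable partitions, with partitions written as
  equivalence relations. A relation is measurable if countably many measurable sets separate its
  classes. The measurable hull of \<open>R\<close> is the finest measurable equivalence relation coarser than
  \<open>R\<close>, everything up to null sets.
\<close>

definition measurable_equiv :: "'a measure \<Rightarrow> ('a \<times> 'a) set \<Rightarrow> bool" where
  "measurable_equiv M E \<longleftrightarrow>
     (\<exists>B :: nat \<Rightarrow> 'a set. range B \<subseteq> sets M \<and>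
        E = {(x, y). x \<in> space M \<and> y \<in> space M \<and> (\<forall>n. x \<in> B n \<longleftrightarrow> y \<in> B n)})"

definition finer_mod0 :: "'a measure \<Rightarrow> ('a \<times> 'a) set \<Rightarrow> ('a \<times> 'a) set \<Rightarrow> bool" where
  "finer_mod0 M R E \<longleftrightarrow>
     (\<exists>N \<in> null_sets M. \<forall>x \<in> space M - N. \<forall>y \<in> space M - N. (x, y) \<in> R \<longrightarrow> (x, y) \<in> E)"

definition is_measurable_hull :: "'a measure \<Rightarrow> ('a \<times> 'a) set \<Rightarrow> ('a \<times> 'a) set \<Rightarrow> bool" where
  "is_measurable_hull M R E \<longleftrightarrow>
     measurable_equiv M E \<and> finer_mod0 M R E \<and>
     (\<forall>E'. measurable_equiv M E' \<and> finer_mod0 M R E' \<longrightarrow> finer_mod0 M E E')"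

text \<open>
  On a standard probability space, such as the trajectory space of a countable group, the hull
  exists; two hulls agree off a null set, so the choice does not matter.
\<close>

definition measurable_hull :: "'a measure \<Rightarrow> ('a \<times> 'a) set \<Rightarrow> ('a \<times> 'a) set" where
  "measurable_hull M R = (SOME E. is_measurable_hull M R E)"

definition quotient_measure :: "'a measure \<Rightarrow> ('a \<times> 'a) set \<Rightarrow> 'a set measure" where
  "quotient_measure M E =
     distr M (sigma (space M // E) {A. A \<subseteq> space M // E \<and> \<Union>A \<in> sets M}) (\<lambda>x. E `` {x})"

definition poisson_boundary ::
    "('a, 'b) monoid_scheme \<Rightarrow> 'a measure \<Rightarrow> (nat \<Rightarrow> 'a) set measure" where
  "poisson_boundary G \<mu> =
     (let P = trajectory_measure G \<mu> in quotient_measure P (measurable_hull P (trajectory_rel G)))"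

definition single_point_mod0 :: "'a measure \<Rightarrow> bool" where
  "single_point_mod0 M \<longleftrightarrow> (\<exists>b \<in> space M. AE x in M. x = b)"

definition poisson_boundary_nontrivial :: "('a, 'b) monoid_scheme \<Rightarrow> 'a measure \<Rightarrow> bool" where
  "poisson_boundary_nontrivial G \<mu> \<longleftrightarrow> \<not> single_point_mod0 (poisson_boundary G \<mu>)"

end

theory Submission
  imports Defs
begin

text \<open>
  For \<open>g\<close> in Thompson's group \<open>F\<close> and \<open>v\<close> in the open unit interval let \<open>C g v\<close> be the logarithm of
  the right slope minus the logarithm of the left slope of \<open>g\<close> at \<open>v\<close> (\<open>log_jump\<close>). By the chain
  rule \<open>C (g h) v = C g (h v) + C h v\<close>, and \<open>C g\<close> vanishes off the finitely many break points of
  \<open>g\<close>. Along a trajectory \<open>x\<^sub>n\<close> of the random walk with increments \<open>y\<^sub>n\<close> one has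
  \<open>C x\<^sub>n v = (\<Sum>i<n. C y\<^sub>i (x\<^sub>i v))\<close>. The heart of the proof is that for
  \<open>v = 1/2\<close> this sequence converges almost surely and that its limit, which does not change under
  the relation defining the Poisson boundary, is not almost surely constant.

  Convergence. Let \<open>X\<close> be the orbit of \<open>1/2\<close>. The expectation of \<open>(\<Sum>i. \<bar>C y\<^sub>i (x\<^sub>i (1/2))\<bar>)\<close> is the sum
  over \<open>w \<in> X\<close> of the expected number of visits of \<open>x\<^sub>i (1/2)\<close> to \<open>w\<close> times the mean of
  \<open>\<bar>C y w\<bar>\<close> under \<open>\<mu>\<close>. If the number of visits is bounded in \<open>w\<close>, this is at most a constant times the
  mean of \<open>(\<Sum>w. \<bar>C y w\<bar>)\<close>; the latter sum is a subadditive function of \<open>y\<close>, so it is bounded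
  by a multiple of the word length and has finite mean (\<open>cocycle_moment\<close>, \<open>cocycle_converges\<close>).

  Transience. The counting measure of \<open>X\<close> is invariant under \<open>F\<close>, for every \<open>\<mu>\<close>. Therefore the
  expected numbers of visits \<open>V\<close> up to a given time satisfy a maximum principle,
  \<open>V w \<le> V (1/2)\<close> (\<open>occupation_le_start\<close>), and an energy estimate: the mean over \<open>g\<close> of
  \<open>(\<Sum>w. (V w - V (g w))\<^sup>2)\<close> is at most \<open>2 * V (1/2)\<close> (\<open>mean_displacement_occupation\<close>). Since the
  support of \<open>\<mu>\<close> generates \<open>F\<close> as a semigroup, for each single \<open>g\<close> this sum is at most a constant
  times \<open>V (1/2)\<close>, with a constant that does not depend on the time. On the other hand two elements of
  \<open>F\<close> act on \<open>[1/4, 3/4]\<close> as the contractions onto its two halves, and under them the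
  point \<open>1/2\<close> spans a binary tree in \<open>X\<close>. A binary tree carries a flow of finite energy, so
  \<open>(V (1/2))\<^sup>2\<close> is at most a constant times the sum of the two energies
  (\<open>binary_tree_inequality\<close>). Hence \<open>(V (1/2))\<^sup>2 \<le> K * V (1/2)\<close>, and \<open>V (1/2) \<le> K\<close>
  at all times (\<open>occupation_bounded\<close>).

  Non-constancy. If the limit of \<open>C x\<^sub>n v\<close> is almost surely a constant \<open>c\<close>, then conditioning on
  the first increment shows that the limit of \<open>C x\<^sub>n (g v)\<close> is almost surely \<open>c - C g v\<close>, for every
  \<open>g\<close> (\<open>limit_shift\<close>). Applied to \<open>v = 1/4\<close>, a point of \<open>X\<close>, and to a \<open>g\<close> that fixes \<open>1/4\<close>
  but has different slopes on its two sides, this yields \<open>c = c - C g v\<close> with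
  \<open>C g v \<noteq> 0\<close>.

  The Poisson boundary is a quotient by a measurable hull, given by a choice operator, so existence
  of a hull must be proved as well (\<open>measurable_hull_exists\<close>). A real function that is invariant under the
  trajectory relation then factors through the quotient up to a null set
  (\<open>quotient_by_hull_not_single_point\<close>).
\<close>

section \<open>Existence of measurable hulls\<close>

lemma countable_algebra_containing:
  assumes "countable \<A>" and "\<A> \<subseteq> sets M"
  obtains \<B> where "countable \<B>" "\<A> \<subseteq> \<B>" "\<B> \<subseteq> sets M" "algebra (space M) \<B>"
proof -
  define step where
    "step S = S \<union> {{}} \<union> (\<lambda>A. space M - A) ` S \<union> (\<lambda>(A, B). A \<union> B) ` (S \<times> S)" for S :: "'a set set"
  define L where "L n = (step ^^ n) \<A>" for n
  have L_Suc: "L (Suc n) = step (L n)" for n by (simp add: L_def)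
  have L_mono: "L m \<subseteq> L n" if "m \<le> n" for m n
    by (rule lift_Suc_mono_le[OF _ that]) (auto simp: L_Suc step_def)
  have "countable (L n)" for n
  proof (induction n)
    case 0 then show ?case using assms by (simp add: L_def)
  next
    case (Suc n) then show ?case unfolding L_Suc step_def by (intro countable_Un countable_image countable_SIGMA) auto
  qed
  moreover have "L n \<subseteq> sets M" for n
  proof (induction n)
    case 0 then show ?case using assms by (simp add: L_def)
  next
    case (Suc n) then show ?case unfolding L_Suc step_def by (auto 4 3)
  qed
  moreover have "algebra (space M) (\<Union>n. L n)"
    unfolding algebra_iff_Un
  proof (intro conjI ballI)
    show "(\<Union>n. L n) \<subseteq> Pow (space M)"
      using \<open>\<And>n. L n \<subseteq> sets M\<close> sets.space_closed by blast
    have "{} \<in> L (Suc 0)" by (simp add: L_Suc step_def)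
    then show "{} \<in> (\<Union>n. L n)" by blast
  next
    fix A assume "A \<in> (\<Union>n. L n)"
    then obtain n where "A \<in> L n" by blast
    then have "space M - A \<in> L (Suc n)" by (auto simp: L_Suc step_def)
    then show "space M - A \<in> (\<Union>n. L n)" by blast
  next
    fix A B assume "A \<in> (\<Union>n. L n)" "B \<in> (\<Union>n. L n)"
    then obtain m n where "A \<in> L m" "B \<in> L n" by blast
    then have "(A, B) \<in> L (max m n) \<times> L (max m n)" using L_mono by (meson SigmaI max.cobounded1 max.cobounded2 subsetD)
    then have "A \<union> B \<in> L (Suc (max m n))" unfolding L_Suc step_def by (intro UnI2) force
    then show "A \<union> B \<in> (\<Union>n. L n)" by blast
  qed
  moreover have "\<A> \<subseteq> (\<Union>n. L n)" using L_def[of 0] by auto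
  ultimately show ?thesis by (intro that[of "\<Union>n. L n"]) auto
qed

text \<open>
  The sets that members of \<open>\<B>\<close> approximate in measure form a \<open>\<sigma>\<close>-algebra: for a countable union, cut
  off a tail of small measure and approximate the remaining finitely many sets.
\<close>

lemma (in finite_measure) algebra_dense:
  assumes alg: "algebra (space M) \<B>" and gen: "sets M = sigma_sets (space M) \<B>"
    and "A \<in> sets M" and "e > 0"
  shows "\<exists>B\<in>\<B>. measure M (sym_diff A B) < e"
proof -
  interpret \<B>: algebra "space M" \<B> by fact
  have \<B>_sets [simp, intro]: "B \<in> sets M" if "B \<in> \<B>" for B using that gen by auto
  have "A \<in> sigma_sets (space M) \<B>" using assms gen by simp
  then show ?thesis using \<open>e > 0\<close>
  proof (induction arbitrary: e)
    case (Basic A)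
    then show ?case by (intro bexI[of _ A]) auto
  next
    case Empty
    then show ?case by (intro bexI[of _ "{}"]) auto
  next
    case (Compl A)
    then obtain B where B: "B \<in> \<B>" "measure M (sym_diff A B) < e" by blast
    have "sym_diff (space M - A) (space M - B) = sym_diff A B"
      using sets.sets_into_space[of A M] sets.sets_into_space[OF \<B>_sets[OF B(1)]] Compl gen by auto
    then show ?case using B by (intro bexI[of _ "space M - B"]) auto
  next
    case (Union A)
    have A [measurable]: "A i \<in> sets M" for i using Union gen by simp
    \<comment> \<open>Replace the union by a finite one, then approximate each member within \<open>e / 2 / Suc n\<close>.\<close>
    have "(\<lambda>n. measure M (\<Union>i\<le>n. A i)) \<longlonglongrightarrow> measure M (\<Union>n. \<Union>i\<le>n. A i)"
      by (intro finite_Lim_measure_incseq) (auto simp: incseq_def, use le_trans in blast)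
    moreover have "(\<Union>n. \<Union>i\<le>n. A i) = (\<Union>i. A i)" by auto
    ultimately have "(\<lambda>n. measure M (\<Union>i\<le>n. A i)) \<longlonglongrightarrow> measure M (\<Union>i. A i)" by simp
    then have "\<forall>\<^sub>F n in sequentially. measure M (\<Union>i. A i) - e/2 < measure M (\<Union>i\<le>n. A i)"
      by (rule order_tendstoD) (use Union in auto)
    then obtain n where n: "measure M (\<Union>i. A i) - e/2 < measure M (\<Union>i\<le>n. A i)"
      by (auto simp: eventually_sequentially)
    have "\<exists>B\<in>\<B>. measure M (sym_diff (A i) B) < e / 2 / Suc n" for i
      using Union.IH[of "e / 2 / Suc n" i] Union.prems by simp
    then obtain B where B: "B i \<in> \<B>" "measure M (sym_diff (A i) (B i)) < e / 2 / Suc n" for i by metis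
    have [measurable]: "B i \<in> sets M" for i using B by auto
    have "measure M (sym_diff (\<Union>i. A i) (\<Union>i\<le>n. B i))
        \<le> measure M (((\<Union>i. A i) - (\<Union>i\<le>n. A i)) \<union> (\<Union>i\<le>n. sym_diff (A i) (B i)))"
      by (intro finite_measure_mono) auto
    also have "\<dots> \<le> measure M ((\<Union>i. A i) - (\<Union>i\<le>n. A i)) + measure M (\<Union>i\<le>n. sym_diff (A i) (B i))"
      by (intro measure_Un_le) auto
    also have "measure M ((\<Union>i. A i) - (\<Union>i\<le>n. A i)) = measure M (\<Union>i. A i) - measure M (\<Union>i\<le>n. A i)"
      by (intro finite_measure_Diff) auto
    also have "measure M (\<Union>i\<le>n. sym_diff (A i) (B i)) \<le> (\<Sum>i\<le>n. measure M (sym_diff (A i) (B i)))"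
      by (intro measure_UNION_le) auto
    also have "\<dots> \<le> (\<Sum>i\<le>n. e / 2 / Suc n)" using B by (intro sum_mono less_imp_le) auto
    also have "\<dots> = e / 2" by (simp add: field_simps)
    finally have "measure M (sym_diff (\<Union>i. A i) (\<Union>i\<le>n. B i)) < e" using n by simp
    then show ?case using B(1) by (intro bexI[of _ "\<Union>i\<le>n. B i"]) auto
  qed
qed

text \<open>
  For the distance given by the measure of the symmetric difference, a countably generated
  \<open>\<sigma>\<close>-algebra is a separable pseudometric space, and so is each of its subspaces.
\<close>

lemma (in finite_measure) countable_dense_subfamily:
  assumes "countable \<A>" and gen: "sets M = sigma_sets (space M) \<A>" and "\<I> \<subseteq> sets M"
  obtains \<D> where "countable \<D>" "\<D> \<subseteq> \<I>"
    "\<And>A e. A \<in> \<I> \<Longrightarrow> e > 0 \<Longrightarrow> \<exists>D\<in>\<D>. measure M (sym_diff A D) < e"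
proof -
  have "\<A> \<subseteq> sets M" using gen by auto
  then obtain \<B> where \<B>: "countable \<B>" "\<A> \<subseteq> \<B>" "\<B> \<subseteq> sets M" "algebra (space M) \<B>"
    using countable_algebra_containing[of \<A> M] \<open>countable \<A>\<close> by blast
  have gen\<B>: "sets M = sigma_sets (space M) \<B>"
    using \<B> gen by (metis antisym sets.sigma_sets_subset sigma_sets_subseteq)
  \<comment> \<open>One member of \<open>\<I>\<close> close to each \<open>B\<close>, at each scale where there is one.\<close>
  define P where "P B n D \<longleftrightarrow> D \<in> \<I> \<and> measure M (sym_diff B D) < 1 / Suc n" for B n D
  define \<D> where "\<D> = (\<lambda>(B, n). SOME D. P B n D) ` {(B, n). B \<in> \<B> \<and> (\<exists>D. P B n D)}"
  have "countable (\<B> \<times> (UNIV :: nat set))" using \<B> by auto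
  then have "countable {(B, n). B \<in> \<B> \<and> (\<exists>D. P B n D)}" by (rule countable_subset[rotated]) auto
  then have "countable \<D>" unfolding \<D>_def by (rule countable_image)
  moreover have "(SOME D. P B n D) \<in> \<I>" if "\<exists>D. P B n D" for B n
    using someI_ex[OF that] by (simp add: P_def)
  then have "\<D> \<subseteq> \<I>" unfolding \<D>_def by auto
  moreover have "\<exists>D\<in>\<D>. measure M (sym_diff A D) < e" if A: "A \<in> \<I>" and "e > 0" for A e
  proof -
    obtain n where n: "1 / Suc n < e / 2" using \<open>e > 0\<close> by (metis nat_approx_posE half_gt_zero)
    obtain B where B: "B \<in> \<B>" "measure M (sym_diff A B) < 1 / Suc n"
      using algebra_dense[OF \<B>(4) gen\<B>, of A "1 / Suc n"] A assms by auto
    have "P B n A" using A B by (simp add: P_def Un_commute)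
    define D where "D = (SOME D. P B n D)"
    have PD: "P B n D" unfolding D_def by (rule someI, fact)
    have "D \<in> \<D>" unfolding \<D>_def D_def using \<open>P B n A\<close> B by (intro image_eqI[of _ _ "(B, n)"]) auto
    have [measurable]: "A \<in> sets M" "B \<in> sets M" "D \<in> sets M"
      using A B PD \<B> assms by (auto simp: P_def)
    have "measure M (sym_diff A D) \<le> measure M (sym_diff A B \<union> sym_diff B D)"
      by (intro finite_measure_mono) auto
    also have "\<dots> \<le> measure M (sym_diff A B) + measure M (sym_diff B D)"
      by (intro measure_Un_le) auto
    also have "\<dots> < e" using B PD n by (simp add: P_def)
    finally show ?thesis using \<open>D \<in> \<D>\<close> by blast
  qed
  ultimately show ?thesis using that by blast
qed

text \<open>
  The sets that are invariant under \<open>R\<close> up to a null set are exactly the measurable sets that may separate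
  the classes of a measurable relation coarser than \<open>R\<close>. There are uncountably many of them; a
  countable dense subfamily defines the hull, because each invariant set is recovered almost everywhere as the limit of a
  rapidly convergent sequence of members of the subfamily.
\<close>

lemma (in finite_measure) measurable_hull_exists:
  assumes "countable \<A>" and gen: "sets M = sigma_sets (space M) \<A>"
  shows "\<exists>E. is_measurable_hull M R E"
proof -
  define inv_on where "inv_on N A \<longleftrightarrow> (\<forall>x\<in>space M - N. \<forall>y\<in>space M - N. (x, y) \<in> R \<longrightarrow> (x \<in> A \<longleftrightarrow> y \<in> A))" for N A
  define \<I> where "\<I> = {A \<in> sets M. \<exists>N\<in>null_sets M. inv_on N A}"
  obtain \<D> where \<D>: "countable \<D>" "\<D> \<subseteq> \<I>"
    "\<And>A e. A \<in> \<I> \<Longrightarrow> e > 0 \<Longrightarrow> \<exists>D\<in>\<D>. measure M (sym_diff A D) < e"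
    using countable_dense_subfamily[OF assms, of \<I>] unfolding \<I>_def by blast
  have "{} \<in> \<I>" by (auto simp: \<I>_def inv_on_def)
  then have "\<D> \<noteq> {}" using \<D>(3)[of "{}" 1] by auto
  then obtain B :: "nat \<Rightarrow> 'a set" where B: "range B = \<D>" using \<D>(1) uncountable_def by blast
  define E where "E = {(x, y). x \<in> space M \<and> y \<in> space M \<and> (\<forall>n::nat. x \<in> B n \<longleftrightarrow> y \<in> B n)}"
  have "B n \<in> \<I>" for n using \<D>(2) unfolding B[symmetric] by auto
  then have B_sets [measurable]: "B n \<in> sets M" and ex_N: "\<exists>N\<in>null_sets M. inv_on N (B n)" for n
    unfolding \<I>_def by blast+
  have "\<exists>N. \<forall>n. N n \<in> null_sets M \<and> inv_on (N n) (B n)"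
    by (rule choice) (use ex_N in blast)
  then obtain N where N: "N n \<in> null_sets M" "inv_on (N n) (B n)" for n by blast
  have "finer_mod0 M R E"
    unfolding finer_mod0_def
  proof (intro bexI[of _ "\<Union>n. N n"] ballI impI)
    show "(\<Union>n. N n) \<in> null_sets M" using N by (intro null_sets_UN)
  next
    fix x y assume "x \<in> space M - (\<Union>n. N n)" "y \<in> space M - (\<Union>n. N n)" "(x, y) \<in> R"
    then show "(x, y) \<in> E" using N(2) unfolding inv_on_def E_def by blast
  qed
  moreover have "measurable_equiv M E"
    unfolding measurable_equiv_def E_def using B_sets by (intro exI[of _ B]) auto
  moreover have "finer_mod0 M E E'" if E': "measurable_equiv M E'" "finer_mod0 M R E'" for E'
  proof -
    obtain B' :: "nat \<Rightarrow> 'a set" where B': "range B' \<subseteq> sets M"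
      "E' = {(x, y). x \<in> space M \<and> y \<in> space M \<and> (\<forall>n. x \<in> B' n \<longleftrightarrow> y \<in> B' n)}"
      using E'(1) unfolding measurable_equiv_def by blast
    have *: "\<exists>N\<in>null_sets M. \<forall>x\<in>space M - N. \<forall>y\<in>space M - N. (x, y) \<in> E \<longrightarrow> (x \<in> B' n \<longleftrightarrow> y \<in> B' n)" for n
    proof -
      have "B' n \<in> \<I>"
      proof -
        obtain N where "N \<in> null_sets M" and N: "\<forall>x\<in>space M - N. \<forall>y\<in>space M - N. (x, y) \<in> R \<longrightarrow> (x, y) \<in> E'"
          using E'(2) unfolding finer_mod0_def by blast
        moreover have "inv_on N (B' n)"
          using N unfolding inv_on_def B'(2) by auto
        ultimately show ?thesis using B'(1) unfolding \<I>_def by auto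
      qed
      then have "\<exists>k. measure M (sym_diff (B' n) (B k)) < (1/2) ^ m" for m
        using \<D>(3)[of "B' n" "(1/2)^m"] B by auto
      then obtain k where k: "measure M (sym_diff (B' n) (B (k m))) < (1/2) ^ m" for m by metis
      have [measurable]: "B' n \<in> sets M" using B' by auto
      \<comment> \<open>By Borel--Cantelli, almost every point lies in \<open>B' n\<close> iff it lies in almost all \<open>B (k m)\<close>.\<close>
      have "AE x in M. eventually (\<lambda>m. x \<in> space M - sym_diff (B' n) (B (k m))) sequentially"
        using k by (intro borel_cantelli_AE1 summable_comparison_test'[OF summable_geometric[of "1/2::real"], of 0])
          (auto simp: less_imp_le less_top[symmetric])
      then obtain N where N: "N \<in> null_sets M"
        "\<And>x. x \<in> space M - N \<Longrightarrow> eventually (\<lambda>m. x \<in> space M - sym_diff (B' n) (B (k m))) sequentially"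
        unfolding eventually_ae_filter by blast
      have "x \<in> B' n \<longleftrightarrow> y \<in> B' n" if "x \<in> space M - N" "y \<in> space M - N" "(x, y) \<in> E" for x y
      proof -
        have "\<exists>m. x \<in> space M - sym_diff (B' n) (B (k m)) \<and> y \<in> space M - sym_diff (B' n) (B (k m))"
          using eventually_conj[OF N(2)[OF that(1)] N(2)[OF that(2)]]
          by (auto simp: eventually_sequentially)
        then show ?thesis using that(3) unfolding E_def by blast
      qed
      then show ?thesis using N(1) by blast
    qed
    have "\<exists>N. \<forall>n. N n \<in> null_sets M \<and>
        (\<forall>x\<in>space M - N n. \<forall>y\<in>space M - N n. (x, y) \<in> E \<longrightarrow> (x \<in> B' n \<longleftrightarrow> y \<in> B' n))"
      by (rule choice) (use * in blast)
    then obtain N where N: "N n \<in> null_sets M"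
      "\<And>x y. x\<in>space M - N n \<Longrightarrow> y\<in>space M - N n \<Longrightarrow> (x, y) \<in> E \<Longrightarrow> (x \<in> B' n \<longleftrightarrow> y \<in> B' n)" for n
      by blast
    show ?thesis
      unfolding finer_mod0_def
    proof (intro bexI[of _ "\<Union>n. N n"] ballI impI)
      show "(\<Union>n. N n) \<in> null_sets M" using N by (intro null_sets_UN)
    next
      fix x y assume "x \<in> space M - (\<Union>n. N n)" "y \<in> space M - (\<Union>n. N n)" "(x, y) \<in> E"
      then show "(x, y) \<in> E'" using N(2) unfolding B' by blast
    qed
  qed
  ultimately show ?thesis unfolding is_measurable_hull_def by blast
qed

text \<open>
  If the quotient is a point, then almost all points lie in one class of the hull, on which every
  measurable \<open>R\<close>-invariant function is almost surely constant.
\<close>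

lemma (in prob_space) quotient_by_hull_not_single_point:
  fixes f :: "'a \<Rightarrow> real"
  assumes hull: "is_measurable_hull M R E"
    and f [measurable]: "f \<in> borel_measurable M"
    and inv: "\<And>x y. (x, y) \<in> R \<Longrightarrow> f x = f y"
    and nonconst: "\<And>c. \<not> (AE x in M. f x = c)"
  shows "\<not> single_point_mod0 (quotient_measure M E)"
proof
  let ?Q = "sigma (space M // E) {A. A \<subseteq> space M // E \<and> \<Union>A \<in> sets M}"
  assume "single_point_mod0 (quotient_measure M E)"
  then obtain b where b: "AE C in quotient_measure M E. C = b"
    unfolding single_point_mod0_def by blast
  obtain B :: "nat \<Rightarrow> 'a set" where B: "range B \<subseteq> sets M"
    "E = {(x, y). x \<in> space M \<and> y \<in> space M \<and> (\<forall>n. x \<in> B n \<longleftrightarrow> y \<in> B n)}"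
    using hull unfolding is_measurable_hull_def measurable_equiv_def by blast
  have class_eq: "\<Union>A = (\<lambda>x. E `` {x}) -` A \<inter> space M" if "A \<subseteq> space M // E" for A
  proof (intro equalityI subsetI)
    fix x assume "x \<in> \<Union>A"
    then obtain z where "E `` {z} \<in> A" "x \<in> E `` {z}" using \<open>A \<subseteq> space M // E\<close> unfolding quotient_def by blast
    moreover then have "E `` {x} = E `` {z}" unfolding B by auto
    ultimately show "x \<in> (\<lambda>x. E `` {x}) -` A \<inter> space M" unfolding B by auto
  next
    fix x assume "x \<in> (\<lambda>x. E `` {x}) -` A \<inter> space M"
    then show "x \<in> \<Union>A" by (intro UnionI[of "E `` {x}"]) (auto simp: B)
  qed
  have "(\<lambda>x. E `` {x}) \<in> measurable M ?Q"
  proof (rule measurable_measure_of)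
    show "(\<lambda>x. E `` {x}) -` A \<inter> space M \<in> sets M"
      if "A \<in> {A. A \<subseteq> space M // E \<and> \<Union>A \<in> sets M}" for A
      using that class_eq[of A] by simp
  qed (auto simp: quotientI)
  then have "AE x in M. E `` {x} = b"
    using b unfolding quotient_measure_def by (rule AE_distrD)
  then obtain N where N: "N \<in> null_sets M" "\<And>x. x \<in> space M - N \<Longrightarrow> E `` {x} = b"
    unfolding eventually_ae_filter by blast
  have allE: "(x, y) \<in> E" if "x \<in> space M - N" "y \<in> space M - N" for x y
  proof -
    have "y \<in> E `` {y}" using that unfolding B by auto
    then show ?thesis using N(2)[of x] N(2)[of y] that by auto
  qed
  \<comment> \<open>The level sets of \<open>f\<close> form a measurable relation coarser than \<open>R\<close>, hence coarser than the hull.\<close>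
  obtain r :: "nat \<Rightarrow> rat" where r: "surj r" using surj_from_nat by blast
  define E' where "E' = {(x, y). x \<in> space M \<and> y \<in> space M \<and> f x = f y}"
  have E'_eq: "E' = {(x, y). x \<in> space M \<and> y \<in> space M \<and>
      (\<forall>n. x \<in> {x \<in> space M. f x < of_rat (r n)} \<longleftrightarrow> y \<in> {x \<in> space M. f x < of_rat (r n)})}"
  proof -
    have "f x = f y" if "\<And>n. f x < of_rat (r n) \<longleftrightarrow> f y < of_rat (r n)" for x y
    proof (rule ccontr)
      assume "f x \<noteq> f y"
      then obtain q where "(f x < of_rat q) \<noteq> (f y < of_rat q)"
        by (metis linorder_neqE of_rat_dense not_less_iff_gr_or_eq)
      then show False using that r by (metis surjD)
    qed
    then show ?thesis unfolding E'_def by fastforce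
  qed
  have "measurable_equiv M E'"
    unfolding measurable_equiv_def using E'_eq
    by (intro exI[of _ "\<lambda>n. {x \<in> space M. f x < of_rat (r n)}"]) auto
  moreover have "finer_mod0 M R E'"
    unfolding finer_mod0_def E'_def using inv by (intro bexI[of _ "{}"]) auto
  ultimately have "finer_mod0 M E E'" using hull unfolding is_measurable_hull_def by blast
  then obtain N' where N': "N' \<in> null_sets M"
    "\<And>x y. x \<in> space M - N' \<Longrightarrow> y \<in> space M - N' \<Longrightarrow> (x, y) \<in> E \<Longrightarrow> (x, y) \<in> E'"
    unfolding finer_mod0_def by blast
  have null: "N \<union> N' \<in> null_sets M" using N N' by auto
  have "f x = f y" if "x \<in> space M - (N \<union> N')" "y \<in> space M - (N \<union> N')" for x y
    using allE[of x y] N'(2)[of x y] that unfolding E'_def by auto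
  then obtain c where "\<And>x. x \<in> space M - (N \<union> N') \<Longrightarrow> f x = c"
    by metis
  then have "AE x in M. f x = c"
    unfolding eventually_ae_filter using null by (intro bexI[of _ "N \<union> N'"]) auto
  then show False using nonconst by blast
qed

section \<open>Averages along a binary tree\<close>

text \<open>
  Here \<open>p k\<close> enumerates level \<open>k\<close> of a binary tree in \<open>X\<close>, whose edges are given by \<open>a\<close> and \<open>b\<close>. The
  mean of \<open>U\<close> over a level differs from the mean over the next one by an average of \<open>2 ^ Suc k\<close>
  increments of \<open>U\<close> along edges; by Cauchy--Schwarz it is at most \<open>sqrt ((A + B) / 2 ^ Suc k)\<close>. These bounds form a
  convergent series, and the means tend to \<open>0\<close> because \<open>U\<close> is summable. Bounding
  \<open>sqrt (1/2)\<close> by \<open>3/4\<close> keeps the constant rational: the geometric series sums to \<open>3\<close>, hence the factor \<open>9\<close>.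
\<close>

lemma binary_tree_inequality:
  fixes U :: "'x \<Rightarrow> real" and p :: "nat \<Rightarrow> nat \<Rightarrow> 'x"
  assumes nonneg: "\<And>v. 0 \<le> U v"
    and finite_sum: "(\<integral>\<^sup>+ v. ennreal (U v) \<partial>count_space X) < \<infinity>"
    and p_X: "\<And>k j. j < 2 ^ k \<Longrightarrow> p k j \<in> X"
    and p_inj: "\<And>k. inj_on (p k) {..<2 ^ k}"
    and p_a: "\<And>k j. j < 2 ^ k \<Longrightarrow> p (Suc k) j = a (p k j)"
    and p_b: "\<And>k j. j < 2 ^ k \<Longrightarrow> p (Suc k) (j + 2 ^ k) = b (p k j)"
    and A: "(\<integral>\<^sup>+ v. ennreal ((U v - U (a v))\<^sup>2) \<partial>count_space X) \<le> ennreal A" "0 \<le> A"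
    and B: "(\<integral>\<^sup>+ v. ennreal ((U v - U (b v))\<^sup>2) \<partial>count_space X) \<le> ennreal B" "0 \<le> B"
  shows "(U (p 0 0))\<^sup>2 \<le> 9 * (A + B)"
proof -
  have level_sum: "(\<Sum>j<2 ^ k. f (p k j)) \<le> C"
    if "(\<integral>\<^sup>+ v. ennreal (f v) \<partial>count_space X) \<le> ennreal C" "0 \<le> C" and f: "\<And>v. 0 \<le> f v" for f C k
  proof -
    have "ennreal (\<Sum>j<2 ^ k. f (p k j)) = ennreal (\<Sum>v\<in>p k ` {..<2 ^ k}. f v)"
      by (simp add: sum.reindex[OF p_inj])
    also have "\<dots> = (\<integral>\<^sup>+ v. ennreal (f v) \<partial>count_space (p k ` {..<2 ^ k}))"
      using f by (simp add: nn_integral_count_space_finite sum_ennreal)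
    also have "\<dots> \<le> (\<integral>\<^sup>+ v. ennreal (f v) \<partial>count_space X)"
      by (subst (1 2) nn_integral_count_space_indicator)
        (use p_X in \<open>auto intro!: nn_integral_mono simp: indicator_def\<close>)
    also have "\<dots> \<le> ennreal C" by (rule that)
    finally show ?thesis using \<open>0 \<le> C\<close> by simp
  qed
  have split: "(\<Sum>j<2 ^ Suc k. f j) = (\<Sum>j<2 ^ k. f j + f (j + 2 ^ k))" for f :: "nat \<Rightarrow> real" and k
  proof -
    have "(\<Sum>j<m + n. f j) = (\<Sum>j<m. f j) + (\<Sum>j<n. f (j + m))" for m n
      by (induction n) (simp_all add: add.commute)
    from this[of "2 ^ k" "2 ^ k"] show ?thesis by (simp add: sum.distrib mult_2)
  qed
  define M where "M k = (\<Sum>j<2 ^ k. U (p k j)) / 2 ^ k" for k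
  define s where "s = sqrt (A + B)"
  have step: "\<bar>M k - M (Suc k)\<bar> \<le> s * (3/4) ^ Suc k" for k
  proof -
    define da where "da j = U (p k j) - U (a (p k j))" for j
    define db where "db j = U (p k j) - U (b (p k j))" for j
    have "M k - M (Suc k) = ((\<Sum>j<2 ^ k. da j) + (\<Sum>j<2 ^ k. db j)) / 2 ^ Suc k"
      unfolding M_def split by (simp add: p_a p_b da_def db_def sum.distrib sum_subtractf field_simps)
    then have "(M k - M (Suc k))\<^sup>2 = ((\<Sum>j<2 ^ k. da j) + (\<Sum>j<2 ^ k. db j))\<^sup>2 / (2 ^ Suc k)\<^sup>2"
      by (simp add: power_divide)
    also have "\<dots> \<le> (2 * 2 ^ k * (A + B)) / (2 ^ Suc k)\<^sup>2"
    proof (rule divide_right_mono)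
      have "(\<Sum>j<2 ^ k. da j)\<^sup>2 \<le> (\<Sum>j<2 ^ k. (da j)\<^sup>2) * 2 ^ k" "(\<Sum>j<2 ^ k. db j)\<^sup>2 \<le> (\<Sum>j<2 ^ k. (db j)\<^sup>2) * 2 ^ k"
        using sum_squared_le_sum_of_squares[of da "{..<2 ^ k}"] sum_squared_le_sum_of_squares[of db "{..<2 ^ k}"] by simp_all
      moreover have "(\<Sum>j<2 ^ k. (da j)\<^sup>2) \<le> A" "(\<Sum>j<2 ^ k. (db j)\<^sup>2) \<le> B"
        unfolding da_def db_def
        using level_sum[OF A(1,2), of k] level_sum[OF B(1,2), of k] by simp_all
      ultimately have *: "(\<Sum>j<2 ^ k. da j)\<^sup>2 \<le> A * 2 ^ k" "(\<Sum>j<2 ^ k. db j)\<^sup>2 \<le> B * 2 ^ k"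
        by (meson mult_right_mono order_trans zero_le_numeral zero_le_power)+
      have "(x + y)\<^sup>2 \<le> 2 * (x\<^sup>2 + y\<^sup>2)" for x y :: real
        using zero_le_power2[of "x - y"] by (simp add: power2_eq_square algebra_simps)
      then have "((\<Sum>j<2 ^ k. da j) + (\<Sum>j<2 ^ k. db j))\<^sup>2 \<le> 2 * ((\<Sum>j<2 ^ k. da j)\<^sup>2 + (\<Sum>j<2 ^ k. db j)\<^sup>2)" .
      also have "\<dots> \<le> 2 * 2 ^ k * (A + B)" using * by (simp add: algebra_simps)
      finally show "((\<Sum>j<2 ^ k. da j) + (\<Sum>j<2 ^ k. db j))\<^sup>2 \<le> 2 * 2 ^ k * (A + B)" .
    qed simp
    also have "\<dots> = (A + B) * (1/2) ^ Suc k"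
      by (simp add: power2_eq_square power_divide field_simps)
    also have "\<dots> \<le> (A + B) * (9/16) ^ Suc k"
      using A(2) B(2) by (intro mult_left_mono power_mono) auto
    also have "\<dots> = (s * (3/4) ^ Suc k)\<^sup>2"
    proof -
      have "((9/16) ^ Suc k :: real) = ((3/4) ^ Suc k)\<^sup>2"
        by (simp only: power2_eq_square power_mult_distrib[symmetric]) simp
      then show ?thesis using A(2) B(2) by (simp add: s_def power_mult_distrib del: power_Suc)
    qed
    finally have "\<bar>M k - M (Suc k)\<bar> \<le> \<bar>s * (3/4) ^ Suc k\<bar>"
      by (simp only: abs_le_square_iff)
    moreover have "0 \<le> s * (3/4) ^ Suc k" using A(2) B(2) by (simp add: s_def)
    ultimately show ?thesis by simp
  qed
  have "M 0 \<le> M n + 3 * s * (1 - (3/4) ^ n)" for n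
  proof (induction n)
    case (Suc n)
    have "M n \<le> M (Suc n) + s * (3/4) ^ Suc n" using step[of n] by linarith
    with Suc show ?case by (simp add: algebra_simps)
  qed simp
  moreover have "3 * s * (1 - (3/4) ^ n) \<le> 3 * s" for n
    using A(2) B(2) by (simp add: s_def algebra_simps)
  ultimately have M0: "M 0 \<le> M n + 3 * s" for n by (meson add_left_mono order_trans)
  obtain C where C: "(\<integral>\<^sup>+ v. ennreal (U v) \<partial>count_space X) = ennreal C" "0 \<le> C"
    using finite_sum by (metis ennreal_cases infinity_ennreal_def less_irrefl)
  have "(\<lambda>n. C * (1/2) ^ n + 3 * s) \<longlonglongrightarrow> C * 0 + 3 * s"
    by (intro tendsto_intros LIMSEQ_realpow_zero) auto
  moreover have "M 0 \<le> C * (1/2) ^ n + 3 * s" for n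
  proof -
    have "M n \<le> C / 2 ^ n"
      unfolding M_def using level_sum[of U C n] C nonneg by (intro divide_right_mono) auto
    then show ?thesis using M0[of n] by (simp add: power_divide)
  qed
  ultimately have "M 0 \<le> 3 * s" by (intro LIMSEQ_le_const[of _ "C * 0 + 3 * s", simplified]) auto
  then have "(U (p 0 0))\<^sup>2 \<le> (3 * s)\<^sup>2"
    using nonneg by (intro power_mono) (auto simp: M_def)
  also have "\<dots> = 9 * (A + B)" using A(2) B(2) by (simp add: s_def power_mult_distrib)
  finally show ?thesis .
qed

section \<open>Random walks on a countable orbit\<close>

locale random_action =
  group G + prob_space \<mu> for G :: "('g, 'b) monoid_scheme" (structure) and \<mu> :: "'g measure" +
  fixes X :: "'x set" and act :: "'g \<Rightarrow> 'x \<Rightarrow> 'x"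
  assumes sets_\<mu>: "sets \<mu> = Pow (carrier G)"
    and countable_carrier: "countable (carrier G)"
    and countable_X: "countable X"
    and act_closed: "\<And>g v. g \<in> carrier G \<Longrightarrow> v \<in> X \<Longrightarrow> act g v \<in> X"
    and act_one: "\<And>v. v \<in> X \<Longrightarrow> act \<one> v = v"
    and act_mult: "\<And>g h v. g \<in> carrier G \<Longrightarrow> h \<in> carrier G \<Longrightarrow> v \<in> X \<Longrightarrow> act (g \<otimes> h) v = act g (act h v)"
begin

lemma space_\<mu>: "space \<mu> = carrier G"
  using sets_eq_imp_space_eq[of \<mu> "count_space (carrier G)"] sets_\<mu> by simp

lemma measurable_\<mu> [measurable (raw)]: "f \<in> borel_measurable \<mu>"
  by (simp add: measurable_def space_\<mu> sets_\<mu>)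

lemma act_inv:
  assumes "g \<in> carrier G" "v \<in> X"
  shows "act g (act (inv g) v) = v" "act (inv g) (act g v) = v"
  using assms by (simp_all flip: act_mult add: act_one)

lemma bij_act: "g \<in> carrier G \<Longrightarrow> bij_betw (act g) X X"
  by (rule bij_betw_byWitness[where f' = "act (inv g)"]) (auto simp: act_inv act_closed)

lemma nn_integral_act:
  "g \<in> carrier G \<Longrightarrow> (\<integral>\<^sup>+ v. f (act g v) \<partial>count_space X) = (\<integral>\<^sup>+ v. f v \<partial>count_space X)"
  by (rule nn_integral_bij_count_space[OF bij_act])

lemma nn_integral_swap:
  "(\<integral>\<^sup>+ g. (\<integral>\<^sup>+ v. f g v \<partial>count_space X) \<partial>\<mu>) = (\<integral>\<^sup>+ v. (\<integral>\<^sup>+ g. f g v \<partial>\<mu>) \<partial>count_space X)"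
proof -
  interpret X: sigma_finite_measure "count_space X"
    by (rule sigma_finite_measure_count_space_countable[OF countable_X])
  interpret P: pair_sigma_finite "count_space X" \<mu> ..
  show ?thesis
    by (rule P.Fubini'[of "\<lambda>v g. f g v"])
      (intro measurable_pair_measure_countable1 countable_X, simp)
qed

text \<open>
  The transition operator of the Markov chain \<open>x\<^sub>n v\<close> on \<open>X\<close>, acting on functions, and the dual operator, acting on
  distributions.
\<close>

definition step_from :: "('x \<Rightarrow> ennreal) \<Rightarrow> 'x \<Rightarrow> ennreal" where
  "step_from f v = (\<integral>\<^sup>+ g. f (act g v) \<partial>\<mu>)"

definition step_to :: "('x \<Rightarrow> ennreal) \<Rightarrow> 'x \<Rightarrow> ennreal" where
  "step_to f w = (\<integral>\<^sup>+ g. f (act (inv g) w) \<partial>\<mu>)"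

text \<open>
  Each \<open>g\<close> permutes \<open>X\<close>, so that \<open>w = act g v\<close> may be substituted in the sum over \<open>X\<close>. The
  estimates below rest on this invariance of the counting measure.
\<close>

lemma step_adjoint:
  "(\<integral>\<^sup>+ w. step_to V w * f w \<partial>count_space X) = (\<integral>\<^sup>+ v. V v * step_from f v \<partial>count_space X)"
proof -
  have "(\<integral>\<^sup>+ w. step_to V w * f w \<partial>count_space X) =
      (\<integral>\<^sup>+ g. (\<integral>\<^sup>+ w. V (act (inv g) w) * f w \<partial>count_space X) \<partial>\<mu>)"
    unfolding nn_integral_swap step_to_def by (simp add: nn_integral_multc)
  also have "\<dots> = (\<integral>\<^sup>+ g. (\<integral>\<^sup>+ v. V v * f (act g v) \<partial>count_space X) \<partial>\<mu>)"
  proof (rule nn_integral_cong)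
    fix g assume "g \<in> space \<mu>"
    then have g: "g \<in> carrier G" by (simp add: space_\<mu>)
    have "(\<integral>\<^sup>+ w. V (act (inv g) w) * f w \<partial>count_space X) =
        (\<integral>\<^sup>+ v. V (act (inv g) (act g v)) * f (act g v) \<partial>count_space X)"
      by (rule nn_integral_act[OF g, symmetric])
    then show "(\<integral>\<^sup>+ w. V (act (inv g) w) * f w \<partial>count_space X) = (\<integral>\<^sup>+ v. V v * f (act g v) \<partial>count_space X)"
      using g by (simp add: act_inv cong: nn_integral_cong_simp)
  qed
  also have "\<dots> = (\<integral>\<^sup>+ v. V v * step_from f v \<partial>count_space X)"
    unfolding nn_integral_swap step_from_def by (simp add: nn_integral_cmult)
  finally show ?thesis .
qed

text \<open>
  The expected number of times \<open>i < n\<close> at which the walk started in \<open>\<gamma>\<close> is at \<open>w\<close>, computed from the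
  distributions of its positions. The recursion describes the same walk with one more step: count the initial
  position, then move all earlier visits by one step.
\<close>

primrec occupation :: "'x \<Rightarrow> nat \<Rightarrow> 'x \<Rightarrow> ennreal" where
  "occupation \<gamma> 0 = (\<lambda>_. 0)"
| "occupation \<gamma> (Suc n) = (\<lambda>w. indicator {\<gamma>} w + step_to (occupation \<gamma> n) w)"

lemma step_to_const: "step_to (\<lambda>_. c) w = c"
  by (simp add: step_to_def emeasure_space_1)

lemma step_to_mono: "(\<And>v. f v \<le> h v) \<Longrightarrow> step_to f w \<le> step_to h w"
  unfolding step_to_def by (rule nn_integral_mono)

lemma occupation_mono: "occupation \<gamma> n w \<le> occupation \<gamma> (Suc n) w"
proof (induction n arbitrary: w)
  case (Suc n)
  then show ?case by (simp add: step_to_mono add_mono del: add_left_mono)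
qed simp

lemma occupation_le_n: "occupation \<gamma> n w \<le> of_nat n"
proof (induction n arbitrary: w)
  case (Suc n)
  then have "step_to (occupation \<gamma> n) w \<le> of_nat n"
    using step_to_mono[of "occupation \<gamma> n" "\<lambda>_. of_nat n"] by (simp add: step_to_const)
  then have "indicator {\<gamma>} w + step_to (occupation \<gamma> n) w \<le> 1 + of_nat n"
    by (intro add_mono) (simp_all add: indicator_def)
  then show ?case by simp
qed simp

lemma occupation_finite: "occupation \<gamma> n w < \<infinity>"
  using occupation_le_n[of \<gamma> n w] by (simp add: order.strict_trans1 of_nat_less_top)

text \<open>
  The maximum principle for the dual chain: off \<open>\<gamma>\<close>, the occupation function is an average of its values one step earlier.
\<close>

lemma occupation_le_start:
  assumes "v \<in> X"
  shows "occupation \<gamma> n v \<le> occupation \<gamma> n \<gamma>"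
  using assms
proof (induction n arbitrary: v)
  case (Suc n)
  show ?case
  proof (cases "v = \<gamma>")
    case False
    have "occupation \<gamma> (Suc n) v = (\<integral>\<^sup>+ g. occupation \<gamma> n (act (inv g) v) \<partial>\<mu>)"
      using False by (simp add: step_to_def)
    also have "\<dots> \<le> (\<integral>\<^sup>+ g. occupation \<gamma> n \<gamma> \<partial>\<mu>)"
      using Suc.prems by (intro nn_integral_mono Suc.IH act_closed) (auto simp: space_\<mu>)
    also have "\<dots> \<le> occupation \<gamma> (Suc n) \<gamma>"
      using occupation_mono[of \<gamma> n \<gamma>] by (simp add: emeasure_space_1 del: occupation.simps)
    finally show ?thesis .
  qed simp
qed simp

lemma occupation_total:
  assumes "\<gamma> \<in> X"
  shows "(\<integral>\<^sup>+ v. occupation \<gamma> n v \<partial>count_space X) = of_nat n"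
proof (induction n)
  case (Suc n)
  have "(\<integral>\<^sup>+ v. occupation \<gamma> (Suc n) v \<partial>count_space X) =
      (\<integral>\<^sup>+ v. indicator {\<gamma>} v \<partial>count_space X) + (\<integral>\<^sup>+ v. step_to (occupation \<gamma> n) v * 1 \<partial>count_space X)"
    by (simp add: nn_integral_add)
  also have "\<dots> = 1 + of_nat n"
    unfolding step_adjoint using assms Suc
    by (simp add: step_from_def emeasure_space_1 nn_integral_indicator)
  finally show ?case by simp
qed simp

text \<open>
  The expected sum of \<open>f\<close> over the first \<open>n\<close> positions of the walk started in \<open>v\<close>, by a recursion on the
  first step.
\<close>

definition green :: "nat \<Rightarrow> ('x \<Rightarrow> ennreal) \<Rightarrow> 'x \<Rightarrow> ennreal" where
  "green n f = ((\<lambda>h v. f v + step_from h v) ^^ n) (\<lambda>_. 0)"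

lemma green_0: "green 0 f v = 0"
  by (simp add: green_def)

lemma green_Suc: "green (Suc n) f v = f v + step_from (green n f) v"
  by (simp add: green_def)

text \<open>
  Splitting off the last summand in place of the first one; this is the recursion that matches that of
  \<open>occupation\<close> under the duality of the two operators.
\<close>

lemma green_Suc_right: "green (Suc n) f v = f v + green n (step_from f) v"
proof (induction n arbitrary: v)
  case 0
  show ?case by (simp add: green_Suc green_0 step_from_def)
next
  case (Suc n)
  have "step_from (green (Suc n) f) v = (\<integral>\<^sup>+ g. f (act g v) + green n (step_from f) (act g v) \<partial>\<mu>)"
    by (simp add: step_from_def[of "green (Suc n) f"] Suc)
  also have "\<dots> = green (Suc n) (step_from f) v"
    by (simp add: nn_integral_add green_Suc step_from_def)
  finally show ?case by (subst green_Suc) simp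
qed

lemma green_eq_occupation:
  assumes "\<gamma> \<in> X"
  shows "green n f \<gamma> = (\<integral>\<^sup>+ v. occupation \<gamma> n v * f v \<partial>count_space X)"
proof (induction n arbitrary: f)
  case (Suc n)
  have "(\<integral>\<^sup>+ v. occupation \<gamma> (Suc n) v * f v \<partial>count_space X) =
      (\<integral>\<^sup>+ v. indicator {\<gamma>} v * f v \<partial>count_space X) + (\<integral>\<^sup>+ v. step_to (occupation \<gamma> n) v * f v \<partial>count_space X)"
    by (simp add: nn_integral_add distrib_right)
  also have "(\<integral>\<^sup>+ v. indicator {\<gamma>} v * f v \<partial>count_space X) = f \<gamma>"
    using assms nn_integral_indicator_singleton[of \<gamma> "count_space X" f] by (simp add: mult.commute)
  also have "(\<integral>\<^sup>+ v. step_to (occupation \<gamma> n) v * f v \<partial>count_space X) = green n (step_from f) \<gamma>"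
    by (simp add: step_adjoint Suc)
  finally show ?case by (simp add: green_Suc_right)
qed (simp add: green_0)

section \<open>The energy of the occupation function\<close>

definition displacement :: "'g \<Rightarrow> ('x \<Rightarrow> real) \<Rightarrow> ennreal" where
  "displacement g U = (\<integral>\<^sup>+ v. ennreal ((U v - U (act g v))\<^sup>2) \<partial>count_space X)"

lemma displacement_mult:
  assumes "g \<in> carrier G" "h \<in> carrier G"
  shows "displacement (g \<otimes> h) U \<le> 2 * displacement h U + 2 * displacement g U"
proof -
  have *: "(x - z)\<^sup>2 \<le> 2 * (x - y)\<^sup>2 + 2 * (y - z)\<^sup>2" for x y z :: real
    using zero_le_power2[of "x + z - 2 * y"] by (simp add: power2_eq_square algebra_simps)
  have "displacement (g \<otimes> h) U \<le> (\<integral>\<^sup>+ v. 2 * ennreal ((U v - U (act h v))\<^sup>2)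
      + 2 * ennreal ((U (act h v) - U (act g (act h v)))\<^sup>2) \<partial>count_space X)"
    unfolding displacement_def
  proof (rule nn_integral_mono)
    fix v assume "v \<in> space (count_space X)"
    then have "act (g \<otimes> h) v = act g (act h v)" using assms by (simp add: act_mult)
    then show "ennreal ((U v - U (act (g \<otimes> h) v))\<^sup>2) \<le> 2 * ennreal ((U v - U (act h v))\<^sup>2)
      + 2 * ennreal ((U (act h v) - U (act g (act h v)))\<^sup>2)"
      using *[of "U v" "U (act g (act h v))" "U (act h v)"]
      by (simp add: ennreal_leI flip: ennreal_plus ennreal_mult' ennreal_numeral)
  qed
  also have "\<dots> = 2 * displacement h U + 2 * (\<integral>\<^sup>+ v. ennreal ((U (act h v) - U (act g (act h v)))\<^sup>2) \<partial>count_space X)"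
    by (simp add: nn_integral_add nn_integral_cmult displacement_def)
  also have "(\<integral>\<^sup>+ v. ennreal ((U (act h v) - U (act g (act h v)))\<^sup>2) \<partial>count_space X) = displacement g U"
    unfolding displacement_def by (rule nn_integral_act[OF assms(2)])
  finally show ?thesis .
qed

text \<open>
  Expanding the square, and using that \<open>g\<close> permutes \<open>X\<close>, turns the mean displacement of \<open>V\<close> into twice
  \<open>\<langle>V, V\<rangle> - \<langle>step_to V, V\<rangle>\<close>. The recursion and the monotonicity in time give
  \<open>V \<le> \<delta> + step_to V\<close>, with \<open>\<delta>\<close> the indicator of \<open>{\<gamma>}\<close>, which bounds the
  difference by \<open>V \<gamma>\<close>. Subtraction is avoided since the values are extended non-negative reals.
\<close>

lemma mean_displacement_occupation:
  assumes "\<gamma> \<in> X"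
  shows "(\<integral>\<^sup>+ g. displacement g (\<lambda>v. enn2real (occupation \<gamma> n v)) \<partial>\<mu>) \<le> 2 * occupation \<gamma> n \<gamma>"
proof -
  define V where "V = occupation \<gamma> n"
  define U where "U v = enn2real (V v)" for v
  define N where "N = (\<integral>\<^sup>+ v. V v * V v \<partial>count_space X)"
  define I where "I g = (\<integral>\<^sup>+ v. V v * V (act g v) \<partial>count_space X)" for g
  have V_eq: "V v = ennreal (U v)" and U_nonneg: "0 \<le> U v" for v
    using occupation_finite[of \<gamma> n v] by (simp_all add: U_def V_def)
  have "N \<le> (\<integral>\<^sup>+ v. of_nat n * V v \<partial>count_space X)"
    unfolding N_def V_def by (intro nn_integral_mono mult_right_mono occupation_le_n) simp
  also have "\<dots> = of_nat n * of_nat n"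
    using occupation_total[OF assms] by (simp add: nn_integral_cmult V_def)
  finally have N_fin: "N < \<infinity>"
    by (simp add: order.strict_trans1 of_nat_less_top ennreal_mult_less_top)
  have parallelogram: "displacement g U + 2 * I g = 2 * N" if g: "g \<in> carrier G" for g
  proof -
    have "displacement g U + 2 * I g =
        (\<integral>\<^sup>+ v. ennreal ((U v - U (act g v))\<^sup>2) + 2 * (V v * V (act g v)) \<partial>count_space X)"
      by (simp add: nn_integral_add nn_integral_cmult displacement_def I_def)
    also have "\<dots> = (\<integral>\<^sup>+ v. V v * V v + V (act g v) * V (act g v) \<partial>count_space X)"
    proof (rule nn_integral_cong)
      fix v
      have "(U v - U (act g v))\<^sup>2 + 2 * (U v * U (act g v)) = U v * U v + U (act g v) * U (act g v)"
        by (simp add: power2_eq_square algebra_simps)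
      then show "ennreal ((U v - U (act g v))\<^sup>2) + 2 * (V v * V (act g v)) = V v * V v + V (act g v) * V (act g v)"
        unfolding V_eq using U_nonneg
        by (simp flip: ennreal_plus ennreal_mult ennreal_numeral)
    qed
    also have "\<dots> = N + N"
      using nn_integral_act[OF g, of "\<lambda>v. V v * V v"] by (simp add: nn_integral_add N_def)
    finally show ?thesis by (simp add: mult_2)
  qed
  have mean_I: "(\<integral>\<^sup>+ g. I g \<partial>\<mu>) = (\<integral>\<^sup>+ w. step_to V w * V w \<partial>count_space X)"
    unfolding I_def nn_integral_swap step_adjoint by (simp add: step_from_def nn_integral_cmult)
  have "N \<le> (\<integral>\<^sup>+ w. (indicator {\<gamma>} w + step_to V w) * V w \<partial>count_space X)"
    unfolding N_def using occupation_mono[of \<gamma> n]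
    by (intro nn_integral_mono mult_right_mono) (simp_all add: V_def)
  also have "\<dots> = (\<integral>\<^sup>+ w. V w * indicator {\<gamma>} w \<partial>count_space X) + (\<integral>\<^sup>+ g. I g \<partial>\<mu>)"
    unfolding mean_I by (simp add: nn_integral_add[symmetric] distrib_left mult.commute)
  also have "(\<integral>\<^sup>+ w. V w * indicator {\<gamma>} w \<partial>count_space X) = V \<gamma>"
    using assms nn_integral_indicator_singleton[of \<gamma> "count_space X" V] by simp
  finally have N_le: "N \<le> V \<gamma> + (\<integral>\<^sup>+ g. I g \<partial>\<mu>)" .
  have total: "(\<integral>\<^sup>+ g. displacement g U \<partial>\<mu>) + 2 * (\<integral>\<^sup>+ g. I g \<partial>\<mu>) = 2 * N"
  proof -
    have "(\<integral>\<^sup>+ g. displacement g U \<partial>\<mu>) + 2 * (\<integral>\<^sup>+ g. I g \<partial>\<mu>) = (\<integral>\<^sup>+ g. displacement g U + 2 * I g \<partial>\<mu>)"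
      by (simp add: nn_integral_add nn_integral_cmult)
    also have "\<dots> = (\<integral>\<^sup>+ g. 2 * N \<partial>\<mu>)"
      using parallelogram by (intro nn_integral_cong) (simp add: space_\<mu>)
    finally show ?thesis by (simp add: emeasure_space_1)
  qed
  also have "\<dots> \<le> 2 * V \<gamma> + 2 * (\<integral>\<^sup>+ g. I g \<partial>\<mu>)"
    using N_le by (metis distrib_left mult_left_mono zero_le)
  finally have le: "(\<integral>\<^sup>+ g. displacement g U \<partial>\<mu>) + 2 * (\<integral>\<^sup>+ g. I g \<partial>\<mu>) \<le> 2 * V \<gamma> + 2 * (\<integral>\<^sup>+ g. I g \<partial>\<mu>)" .
  have "2 * (\<integral>\<^sup>+ g. I g \<partial>\<mu>) \<le> 2 * N" using total by (metis le_iff_add add.commute)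
  also have "2 * N < \<infinity>" using N_fin by (simp add: ennreal_mult_less_top)
  finally have "2 * (\<integral>\<^sup>+ g. I g \<partial>\<mu>) \<noteq> \<infinity>" by auto
  then have "(\<integral>\<^sup>+ g. displacement g U \<partial>\<mu>) \<le> 2 * V \<gamma>"
    using le ennreal_add_left_cancel_le by (metis add.commute)
  then show ?thesis by (simp add: U_def[abs_def] V_def)
qed


lemma semigroup_in_carrier: "s \<in> semigroup_generate G (supp \<mu>) \<Longrightarrow> s \<in> carrier G"
  by (induction rule: semigroup_generate.induct) (auto simp: supp_def space_\<mu>)

text \<open>
  For an atom \<open>g\<close> of \<open>\<mu>\<close> the displacement is at most the mean displacement divided by the mass of the atom; a product of
  atoms is reached along a path. What matters is that \<open>K\<close> is independent of \<open>n\<close>.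
\<close>

lemma displacement_le_occupation:
  assumes "\<gamma> \<in> X" and "s \<in> semigroup_generate G (supp \<mu>)"
  shows "\<exists>K\<ge>0. \<forall>n. displacement s (\<lambda>v. enn2real (occupation \<gamma> n v)) \<le> ennreal K * occupation \<gamma> n \<gamma>"
  using assms(2)
proof (induction rule: semigroup_generate.induct)
  case (incl g)
  then have g: "g \<in> carrier G" and pos: "0 < measure \<mu> {g}" by (auto simp: supp_def space_\<mu>)
  show ?case
  proof (intro exI[of _ "2 / measure \<mu> {g}"] conjI allI)
    fix n
    define D where "D h = displacement h (\<lambda>v. enn2real (occupation \<gamma> n v))" for h
    have "D g * ennreal (measure \<mu> {g}) = (\<integral>\<^sup>+ h. D h * indicator {g} h \<partial>\<mu>)"
      using g by (subst nn_integral_indicator_singleton) (auto simp: sets_\<mu> emeasure_eq_measure)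
    also have "\<dots> \<le> (\<integral>\<^sup>+ h. D h \<partial>\<mu>)" by (intro nn_integral_mono) (simp add: indicator_def)
    also have "\<dots> \<le> 2 * occupation \<gamma> n \<gamma>"
      unfolding D_def by (rule mean_displacement_occupation[OF assms(1)])
    finally have "D g * ennreal (measure \<mu> {g}) * ennreal (1 / measure \<mu> {g})
        \<le> 2 * occupation \<gamma> n \<gamma> * ennreal (1 / measure \<mu> {g})"
      by (rule mult_right_mono) simp
    also have "D g * ennreal (measure \<mu> {g}) * ennreal (1 / measure \<mu> {g}) = D g"
      using pos by (simp add: mult.assoc flip: ennreal_mult)
    also have "2 * occupation \<gamma> n \<gamma> * ennreal (1 / measure \<mu> {g}) = ennreal (2 / measure \<mu> {g}) * occupation \<gamma> n \<gamma>"
      using ennreal_mult[of 2 "1 / measure \<mu> {g}"] by (simp add: ac_simps)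
    finally show "D g \<le> ennreal (2 / measure \<mu> {g}) * occupation \<gamma> n \<gamma>" .
  qed simp
next
  case (mult g h)
  then obtain Kg Kh where K: "0 \<le> Kg" "0 \<le> Kh"
    "\<And>n. displacement g (\<lambda>v. enn2real (occupation \<gamma> n v)) \<le> ennreal Kg * occupation \<gamma> n \<gamma>"
    "\<And>n. displacement h (\<lambda>v. enn2real (occupation \<gamma> n v)) \<le> ennreal Kh * occupation \<gamma> n \<gamma>" by blast
  show ?case
  proof (intro exI[of _ "2 * Kh + 2 * Kg"] conjI allI)
    fix n
    let ?U = "\<lambda>v. enn2real (occupation \<gamma> n v)"
    have "displacement (g \<otimes> h) ?U \<le> 2 * displacement h ?U + 2 * displacement g ?U"
      using mult by (intro displacement_mult semigroup_in_carrier)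
    also have "\<dots> \<le> 2 * (ennreal Kh * occupation \<gamma> n \<gamma>) + 2 * (ennreal Kg * occupation \<gamma> n \<gamma>)"
      using K by (intro add_mono mult_left_mono) auto
    also have "\<dots> = ennreal (2 * Kh + 2 * Kg) * occupation \<gamma> n \<gamma>"
      using K by (simp add: ennreal_mult ennreal_plus distrib_right mult.assoc)
    finally show "displacement (g \<otimes> h) ?U \<le> ennreal (2 * Kh + 2 * Kg) * occupation \<gamma> n \<gamma>" .
  qed (use K in auto)
qed

text \<open>
  Transience. With \<open>x\<close> the occupation of the root, the tree inequality bounds \<open>x\<^sup>2\<close> by the energies along
  \<open>a\<close> and \<open>b\<close>, which are at most a constant times \<open>x\<close>; so \<open>x\<close> is bounded in \<open>n\<close>.
\<close>

lemma occupation_bounded: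
  fixes p :: "nat \<Rightarrow> nat \<Rightarrow> 'x"
  assumes a: "a \<in> semigroup_generate G (supp \<mu>)" and b: "b \<in> semigroup_generate G (supp \<mu>)"
    and p_X: "\<And>k j. j < 2 ^ k \<Longrightarrow> p k j \<in> X"
    and p_inj: "\<And>k. inj_on (p k) {..<2 ^ k}"
    and p_a: "\<And>k j. j < 2 ^ k \<Longrightarrow> p (Suc k) j = act a (p k j)"
    and p_b: "\<And>k j. j < 2 ^ k \<Longrightarrow> p (Suc k) (j + 2 ^ k) = act b (p k j)"
  shows "\<exists>K. \<forall>n. \<forall>v\<in>X. occupation (p 0 0) n v \<le> ennreal K"
proof -
  define \<gamma> where "\<gamma> = p 0 0"
  have \<gamma>: "\<gamma> \<in> X" using p_X[of 0 0] by (simp add: \<gamma>_def)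
  obtain A B where A: "0 \<le> A" "\<And>n. displacement a (\<lambda>v. enn2real (occupation \<gamma> n v)) \<le> ennreal A * occupation \<gamma> n \<gamma>"
    and B: "0 \<le> B" "\<And>n. displacement b (\<lambda>v. enn2real (occupation \<gamma> n v)) \<le> ennreal B * occupation \<gamma> n \<gamma>"
    using displacement_le_occupation[OF \<gamma> a] displacement_le_occupation[OF \<gamma> b] by blast
  have "occupation \<gamma> n v \<le> ennreal (9 * (A + B))" if "v \<in> X" for n v
  proof -
    define U where "U v = enn2real (occupation \<gamma> n v)" for v
    have U: "ennreal (U v) = occupation \<gamma> n v" "0 \<le> U v" for v
      using occupation_finite[of \<gamma> n v] by (simp_all add: U_def)
    have "(U (p 0 0))\<^sup>2 \<le> 9 * (A * U \<gamma> + B * U \<gamma>)"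
    proof (rule binary_tree_inequality[where p = p and X = X and a = "act a" and b = "act b"])
      show "(\<integral>\<^sup>+ v. ennreal (U v) \<partial>count_space X) < \<infinity>"
        using occupation_total[OF \<gamma>, of n] by (simp add: U of_nat_less_top)
      show "(\<integral>\<^sup>+ v. ennreal ((U v - U (act a v))\<^sup>2) \<partial>count_space X) \<le> ennreal (A * U \<gamma>)"
        using A(2)[of n] A(1) U by (simp add: displacement_def U_def[symmetric] ennreal_mult)
      show "(\<integral>\<^sup>+ v. ennreal ((U v - U (act b v))\<^sup>2) \<partial>count_space X) \<le> ennreal (B * U \<gamma>)"
        using B(2)[of n] B(1) U by (simp add: displacement_def U_def[symmetric] ennreal_mult)
    qed (use U A(1) B(1) p_X p_inj p_a p_b in simp_all)
    then have "U \<gamma> * U \<gamma> \<le> 9 * (A + B) * U \<gamma>"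
      by (simp add: \<gamma>_def power2_eq_square algebra_simps)
    then have "U \<gamma> \<le> 9 * (A + B)"
      using U(2)[of \<gamma>] A(1) B(1) by (cases "U \<gamma> = 0") (auto simp: mult_le_cancel_right)
    then have "occupation \<gamma> n \<gamma> \<le> ennreal (9 * (A + B))"
      unfolding U(1)[symmetric] by (rule ennreal_leI)
    then show ?thesis using occupation_le_start[OF that] order_trans by blast
  qed
  then show ?thesis unfolding \<gamma>_def by blast
qed

end

section \<open>Limits along trajectories\<close>

context random_action
begin

abbreviation increments :: "(nat \<Rightarrow> 'g) measure" where
  "increments \<equiv> Pi\<^sub>M UNIV (\<lambda>_. \<mu>)"

sublocale increments: sequence_space \<mu> ..

lemma space_increments: "space increments = UNIV \<rightarrow> carrier G"
  by (simp add: space_PiM space_\<mu> PiE_def)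

lemma walk_closed: "y \<in> UNIV \<rightarrow> carrier G \<Longrightarrow> walk G y n \<in> carrier G"
  by (induction n) auto

lemma walk_case_nat:
  assumes "g \<in> carrier G" "y \<in> UNIV \<rightarrow> carrier G"
  shows "walk G (case_nat g y) (Suc n) = walk G y n \<otimes> g"
proof (induction n)
  case 0
  then show ?case using assms by simp
next
  case (Suc n)
  have "y n \<in> carrier G" using assms by auto
  with Suc show ?case using assms walk_closed[of y n] by (simp add: m_assoc)
qed

lemma measurable_increment: "(\<lambda>y. y n) \<in> measurable increments (count_space (carrier G))"
proof -
  have "(\<lambda>y. y n) \<in> measurable increments \<mu>" by measurable
  then show ?thesis by (simp add: measurable_def space_\<mu> sets_\<mu>)
qed

lemma measurable_increment_walk:
  assumes "\<And>g h. g \<in> carrier G \<Longrightarrow> h \<in> carrier G \<Longrightarrow> F g h \<in> space N"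
    and walk: "(\<lambda>y. walk G y n) \<in> measurable increments (count_space (carrier G))"
  shows "(\<lambda>y. F (y n) (walk G y n)) \<in> measurable increments N"
proof (rule measurable_compose_countable'[where f = "\<lambda>g y. F g (walk G y n)", OF _ measurable_increment countable_carrier])
  fix g assume "g \<in> carrier G"
  then show "(\<lambda>y. F g (walk G y n)) \<in> measurable increments N"
    using assms(1) by (intro measurable_compose_countable'[where f = "\<lambda>h y. F g h", OF _ walk countable_carrier]) auto
qed

lemma measurable_walk: "(\<lambda>y. walk G y n) \<in> measurable increments (count_space (carrier G))"
proof (induction n)
  case (Suc n)
  have "(\<lambda>y. y n \<otimes> walk G y n) \<in> measurable increments (count_space (carrier G))"
    by (rule measurable_increment_walk[where F = "\<lambda>g h. g \<otimes> h", OF _ Suc]) auto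
  then show ?case by (simp only: walk.simps)
next
  case 0
  show ?case unfolding walk.simps by (rule measurable_const) auto
qed

lemma borel_measurable_increment_walk [measurable]:
  fixes F :: "'g \<Rightarrow> 'g \<Rightarrow> 'c :: topological_space"
  shows "(\<lambda>y. F (y n) (walk G y n)) \<in> borel_measurable increments"
  by (rule measurable_increment_walk[where F = F, OF _ measurable_walk]) simp

text \<open>
  The first increment is independent of the sequence of later ones, which is distributed like the whole sequence.
\<close>

lemma nn_integral_increments:
  assumes [measurable]: "f \<in> borel_measurable increments"
  shows "(\<integral>\<^sup>+ y. f y \<partial>increments) = (\<integral>\<^sup>+ g. (\<integral>\<^sup>+ y. f (case_nat g y) \<partial>increments) \<partial>\<mu>)"
proof -
  have m: "(\<lambda>(g, y). case_nat g y) \<in> measurable (\<mu> \<Otimes>\<^sub>M increments) increments"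
    by measurable
  have "(\<integral>\<^sup>+ y. f y \<partial>increments) = (\<integral>\<^sup>+ y. f y \<partial>distr (\<mu> \<Otimes>\<^sub>M increments) increments (\<lambda>(g, y). case_nat g y))"
    by (simp only: increments.PiM_iter)
  also have "\<dots> = (\<integral>\<^sup>+ z. f (case_nat (fst z) (snd z)) \<partial>(\<mu> \<Otimes>\<^sub>M increments))"
    by (subst nn_integral_distr[OF m]) (simp_all add: split_beta')
  also have "\<dots> = (\<integral>\<^sup>+ g. (\<integral>\<^sup>+ y. f (case_nat g y) \<partial>increments) \<partial>\<mu>)"
    by (subst increments.P.nn_integral_fst[symmetric]) (simp_all add: split_beta')
  finally show ?thesis .
qed

lemma AE_increments:
  assumes "AE y in increments. P y"
  shows "AE g in \<mu>. AE y in increments. P (case_nat g y)"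
proof -
  interpret Q: pair_sigma_finite \<mu> increments ..
  have "AE y in distr (\<mu> \<Otimes>\<^sub>M increments) increments (\<lambda>(g, y). case_nat g y). P y"
    using assms by (simp only: increments.PiM_iter)
  then have "AE z in \<mu> \<Otimes>\<^sub>M increments. P (case z of (g, y) \<Rightarrow> case_nat g y)"
    by (rule AE_distrD[rotated]) measurable
  then show ?thesis by (auto dest: Q.AE_pair)
qed

text \<open>
  The first increment \<open>g\<close> moves \<open>v\<close> to \<open>act g v\<close>, and the remaining increments form a walk started there. This
  puts the first increment at the right end of the product, whereas \<open>walk\<close> adds factors on the left
  (see \<open>walk_case_nat\<close>).
\<close>

lemma expected_sum_along_walk:
  assumes "v \<in> X"
  shows "(\<integral>\<^sup>+ y. (\<Sum>i<n. f (y i) (act (walk G y i) v)) \<partial>increments) = green n (\<lambda>w. \<integral>\<^sup>+ g. f g w \<partial>\<mu>) v"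
  using assms
proof (induction n arbitrary: v)
  case (Suc n)
  let ?c = "\<lambda>w. \<integral>\<^sup>+ g. f g w \<partial>\<mu>"
  have "(\<integral>\<^sup>+ y. (\<Sum>i<Suc n. f (y i) (act (walk G y i) v)) \<partial>increments) =
      (\<integral>\<^sup>+ g. (\<integral>\<^sup>+ y. (\<Sum>i<Suc n. f (case_nat g y i) (act (walk G (case_nat g y) i) v)) \<partial>increments) \<partial>\<mu>)"
    by (rule nn_integral_increments) measurable
  also have "\<dots> = (\<integral>\<^sup>+ g. f g v + green n ?c (act g v) \<partial>\<mu>)"
  proof (rule nn_integral_cong)
    fix g assume "g \<in> space \<mu>"
    then have g: "g \<in> carrier G" by (simp add: space_\<mu>)
    have "(\<integral>\<^sup>+ y. (\<Sum>i<Suc n. f (case_nat g y i) (act (walk G (case_nat g y) i) v)) \<partial>increments) =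
        (\<integral>\<^sup>+ y. f g v + (\<Sum>i<n. f (y i) (act (walk G y i) (act g v))) \<partial>increments)"
    proof (rule nn_integral_cong)
      fix y assume "y \<in> space increments"
      then have y: "y \<in> UNIV \<rightarrow> carrier G" by (simp only: space_increments)
      have "(\<Sum>i<n. f (y i) (act (walk G (case_nat g y) (Suc i)) v)) = (\<Sum>i<n. f (y i) (act (walk G y i) (act g v)))"
        using g y Suc.prems by (intro sum.cong) (simp_all only: walk_case_nat act_mult walk_closed)
      then show "(\<Sum>i<Suc n. f (case_nat g y i) (act (walk G (case_nat g y) i) v)) =
          f g v + (\<Sum>i<n. f (y i) (act (walk G y i) (act g v)))"
        unfolding sum.lessThan_Suc_shift using Suc.prems by (simp add: act_one del: walk.simps(2))
    qed
    also have "\<dots> = f g v + green n ?c (act g v)"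
      using Suc.IH[OF act_closed[OF g Suc.prems]]
      by (subst nn_integral_add) (simp_all add: increments.P.emeasure_space_1)
    finally show "(\<integral>\<^sup>+ y. (\<Sum>i<Suc n. f (case_nat g y i) (act (walk G (case_nat g y) i) v)) \<partial>increments) =
        f g v + green n ?c (act g v)" .
  qed
  also have "\<dots> = ?c v + step_from (green n ?c) v"
    by (simp add: nn_integral_add step_from_def)
  finally show ?case by (simp only: green_Suc)
qed (simp add: green_0)

text \<open>
  By the cocycle identity the values along the walk are partial sums of a series, whose
  sum of absolute values has expectation at most \<open>K\<close> times the first moment of the cocycle.
\<close>

lemma cocycle_converges:
  fixes C :: "'g \<Rightarrow> 'x \<Rightarrow> real"
  assumes \<gamma>: "\<gamma> \<in> X"
    and cocycle: "\<And>g h v. g \<in> carrier G \<Longrightarrow> h \<in> carrier G \<Longrightarrow> v \<in> X \<Longrightarrow> C (g \<otimes> h) v = C g (act h v) + C h v"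
    and bounded: "\<And>n v. v \<in> X \<Longrightarrow> occupation \<gamma> n v \<le> ennreal K"
    and moment: "(\<integral>\<^sup>+ g. (\<integral>\<^sup>+ v. ennreal \<bar>C g v\<bar> \<partial>count_space X) \<partial>\<mu>) < \<infinity>"
  shows "AE y in increments. convergent (\<lambda>n. C (walk G y n) \<gamma>)"
proof -
  define d where "d y i = C (y i) (act (walk G y i) \<gamma>)" for y i
  define T where "T = (\<integral>\<^sup>+ g. (\<integral>\<^sup>+ v. ennreal \<bar>C g v\<bar> \<partial>count_space X) \<partial>\<mu>)"
  have [measurable]: "(\<lambda>y. d y i) \<in> borel_measurable increments" for i
    unfolding d_def by measurable
  have "(\<integral>\<^sup>+ y. (\<Sum>i<n. ennreal \<bar>d y i\<bar>) \<partial>increments) \<le> ennreal K * T" for n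
  proof -
    have "(\<integral>\<^sup>+ y. (\<Sum>i<n. ennreal \<bar>d y i\<bar>) \<partial>increments) =
        (\<integral>\<^sup>+ v. occupation \<gamma> n v * (\<integral>\<^sup>+ g. ennreal \<bar>C g v\<bar> \<partial>\<mu>) \<partial>count_space X)"
      unfolding d_def using expected_sum_along_walk[OF \<gamma>, of "\<lambda>g v. ennreal \<bar>C g v\<bar>" n]
      by (simp only: green_eq_occupation[OF \<gamma>])
    also have "\<dots> \<le> (\<integral>\<^sup>+ v. ennreal K * (\<integral>\<^sup>+ g. ennreal \<bar>C g v\<bar> \<partial>\<mu>) \<partial>count_space X)"
      using bounded by (intro nn_integral_mono mult_right_mono) auto
    also have "\<dots> = ennreal K * T"
      unfolding T_def nn_integral_swap by (simp add: nn_integral_cmult)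
    finally show ?thesis .
  qed
  then have "(SUP n. \<integral>\<^sup>+ y. (\<Sum>i<n. ennreal \<bar>d y i\<bar>) \<partial>increments) \<le> ennreal K * T"
    by (intro SUP_least)
  also have "ennreal K * T < \<infinity>" using moment by (simp add: T_def ennreal_mult_less_top)
  also have "(SUP n. \<integral>\<^sup>+ y. (\<Sum>i<n. ennreal \<bar>d y i\<bar>) \<partial>increments) = (\<integral>\<^sup>+ y. (\<Sum>i. ennreal \<bar>d y i\<bar>) \<partial>increments)"
    unfolding suminf_eq_SUP
    by (rule nn_integral_monotone_convergence_SUP[symmetric])
      (auto simp: incseq_def le_fun_def intro!: sum_mono2)
  finally have "(\<integral>\<^sup>+ y. (\<Sum>i. ennreal \<bar>d y i\<bar>) \<partial>increments) \<noteq> \<infinity>" by simp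
  then have "AE y in increments. (\<Sum>i. ennreal \<bar>d y i\<bar>) \<noteq> \<infinity>"
    by (rule nn_integral_noteq_infinite[rotated]) measurable
  then show ?thesis
  proof (rule AE_mp, intro AE_I2 impI)
    fix y assume "y \<in> space increments" and fin: "(\<Sum>i. ennreal \<bar>d y i\<bar>) \<noteq> \<infinity>"
    then have y: "y \<in> UNIV \<rightarrow> carrier G" by (simp only: space_increments)
    have "summable (\<lambda>i. \<bar>d y i\<bar>)" using fin by (intro summable_suminf_not_top) auto
    then have "summable (d y)" by (rule summable_rabs_cancel)
    then have "convergent (\<lambda>n. \<Sum>i<n. d y i)" by (simp add: summable_iff_convergent)
    moreover have "C \<one> \<gamma> = 0" using cocycle[of \<one> \<one> \<gamma>] \<gamma> by (simp add: act_one)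
    have "C (walk G y n) \<gamma> = (\<Sum>i<n. d y i)" for n
    proof (induction n)
      case (Suc n)
      have "y n \<in> carrier G" using y by auto
      then show ?case
        using cocycle[of "y n" "walk G y n" \<gamma>] walk_closed[OF y] \<gamma> Suc by (simp add: d_def)
    qed (simp add: \<open>C \<one> \<gamma> = 0\<close>)
    ultimately show "convergent (\<lambda>n. C (walk G y n) \<gamma>)" by simp
  qed
qed

text \<open>
  For an atom \<open>s\<close> of \<open>\<mu>\<close>, condition on the event that the first increment is \<open>s\<close>: the later
  increments then drive a walk from \<open>act s v\<close>, and the cocycle identity relates the two limits. The claim passes to products.
\<close>

lemma limit_shift:
  fixes C :: "'g \<Rightarrow> 'x \<Rightarrow> real"
  assumes cocycle: "\<And>g h v. g \<in> carrier G \<Longrightarrow> h \<in> carrier G \<Longrightarrow> v \<in> X \<Longrightarrow> C (g \<otimes> h) v = C g (act h v) + C h v"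
    and s: "s \<in> semigroup_generate G (supp \<mu>)" and v: "v \<in> X"
    and lim: "AE y in increments. (\<lambda>n. C (walk G y n) v) \<longlonglongrightarrow> c"
  shows "AE y in increments. (\<lambda>n. C (walk G y n) (act s v)) \<longlonglongrightarrow> c - C s v"
  using s v lim
proof (induction arbitrary: v c rule: semigroup_generate.induct)
  case (incl g)
  then have g: "g \<in> carrier G" and pos: "0 < measure \<mu> {g}" by (auto simp: supp_def space_\<mu>)
  obtain N where N: "N \<in> null_sets \<mu>"
    "{h \<in> space \<mu>. \<not> (AE y in increments. (\<lambda>n. C (walk G (case_nat h y) n) v) \<longlonglongrightarrow> c)} \<subseteq> N"
    using AE_increments[OF incl.prems(2)] unfolding eventually_ae_filter by blast
  have "g \<notin> N"
  proof
    assume "g \<in> N"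
    then have "measure \<mu> {g} \<le> measure \<mu> N" using N(1) by (intro finite_measure_mono) auto
    then show False using pos N(1) by (simp add: null_sets_def emeasure_eq_measure)
  qed
  then have "AE y in increments. (\<lambda>n. C (walk G (case_nat g y) n) v) \<longlonglongrightarrow> c"
    using N(2) g by (auto simp: space_\<mu>)
  then show ?case
  proof (rule AE_mp, intro AE_I2 impI)
    fix y assume "y \<in> space increments" and lim_y: "(\<lambda>n. C (walk G (case_nat g y) n) v) \<longlonglongrightarrow> c"
    then have y: "y \<in> UNIV \<rightarrow> carrier G" by (simp only: space_increments)
    have "(\<lambda>n. C (walk G (case_nat g y) (Suc n)) v) \<longlonglongrightarrow> c"
      by (rule LIMSEQ_Suc[OF lim_y])
    then have "(\<lambda>n. C (walk G y n) (act g v) + C g v) \<longlonglongrightarrow> c"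
      using cocycle[OF walk_closed[OF y] g incl.prems(1)] by (simp only: walk_case_nat[OF g y])
    from tendsto_diff[OF this tendsto_const[of "C g v"]]
    show "(\<lambda>n. C (walk G y n) (act g v)) \<longlonglongrightarrow> c - C g v" by simp
  qed
next
  case (mult g h)
  have gh: "g \<in> carrier G" "h \<in> carrier G" using mult.hyps by (auto intro: semigroup_in_carrier)
  have "AE y in increments. (\<lambda>n. C (walk G y n) (act g (act h v))) \<longlonglongrightarrow> c - C h v - C g (act h v)"
    by (intro mult.IH act_closed gh mult.prems)
  then show ?case using cocycle[OF gh mult.prems(1)] gh mult.prems(1) by (simp add: act_mult algebra_simps)
qed

text \<open>
  An almost surely constant limit would have to change by \<open>C a (act s \<gamma>)\<close> under an element \<open>a\<close> that
  does not move the starting point \<open>act s \<gamma>\<close>.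
\<close>

lemma limit_not_constant:
  fixes C :: "'g \<Rightarrow> 'x \<Rightarrow> real"
  assumes cocycle: "\<And>g h v. g \<in> carrier G \<Longrightarrow> h \<in> carrier G \<Longrightarrow> v \<in> X \<Longrightarrow> C (g \<otimes> h) v = C g (act h v) + C h v"
    and \<gamma>: "\<gamma> \<in> X" and s: "s \<in> semigroup_generate G (supp \<mu>)"
    and a: "a \<in> semigroup_generate G (supp \<mu>)" "act a (act s \<gamma>) = act s \<gamma>" "C a (act s \<gamma>) \<noteq> 0"
  shows "\<not> (AE y in increments. (\<lambda>n. C (walk G y n) \<gamma>) \<longlonglongrightarrow> c)"
proof
  assume 0: "AE y in increments. (\<lambda>n. C (walk G y n) \<gamma>) \<longlonglongrightarrow> c"
  have 1: "AE y in increments. (\<lambda>n. C (walk G y n) (act s \<gamma>)) \<longlonglongrightarrow> c - C s \<gamma>"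
    by (rule limit_shift[where C = C]) (fact cocycle s \<gamma> 0)+
  have s_closed: "act s \<gamma> \<in> X" by (intro act_closed semigroup_in_carrier s \<gamma>)
  have "AE y in increments. (\<lambda>n. C (walk G y n) (act a (act s \<gamma>))) \<longlonglongrightarrow> c - C s \<gamma> - C a (act s \<gamma>)"
    by (rule limit_shift[where C = C]) (fact cocycle a(1) s_closed 1)+
  with 1 have "AE y in increments. False"
    unfolding a(2)
  proof eventually_elim
    case (elim y)
    from LIMSEQ_unique[OF elim] show ?case using a(3) by simp
  qed
  then show False by simp
qed

text \<open>
  Countably many cylinders suffice to generate the \<open>\<sigma>\<close>-algebra of the trajectory space, since \<open>G\<close> is countable.
\<close>

lemma sets_trajectory_measure:
  "sets (trajectory_measure G \<mu>) = sigma_sets (UNIV \<rightarrow> carrier G)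
     ((\<lambda>(n, g). {x \<in> UNIV \<rightarrow> carrier G. x n = g}) ` (UNIV \<times> carrier G))" (is "_ = sigma_sets ?\<Omega> ?\<A>")
proof (rule equalityI)
  have "?\<A> \<subseteq> Pow ?\<Omega>" by (auto simp only: Pow_iff)
  note countable_UN = sigma_algebra.countable_UN''[OF sigma_algebra_sigma_sets[OF this]]
  have gen: "sets (trajectory_measure G \<mu>) = sigma_sets ?\<Omega> {{x \<in> ?\<Omega>. x n \<in> A} | n A. A \<subseteq> carrier G}"
    by (simp add: trajectory_measure_def sets_PiM_single PiE_def)
  have "{x \<in> ?\<Omega>. x n \<in> A} \<in> sigma_sets ?\<Omega> ?\<A>" if "A \<subseteq> carrier G" for n A
  proof -
    have "{x \<in> ?\<Omega>. x n \<in> A} = (\<Union>g\<in>A. {x \<in> ?\<Omega>. x n = g})" by auto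
    moreover have "countable A" using that countable_carrier by (rule countable_subset)
    moreover have "{x \<in> ?\<Omega>. x n = g} \<in> sigma_sets ?\<Omega> ?\<A>" if "g \<in> A" for g
      using that \<open>A \<subseteq> carrier G\<close> by (intro sigma_sets.Basic image_eqI[of _ _ "(n, g)"]) auto
    ultimately show ?thesis by (simp only: countable_UN)
  qed
  then show "sets (trajectory_measure G \<mu>) \<subseteq> sigma_sets ?\<Omega> ?\<A>"
    unfolding gen by (intro sigma_sets_mono) auto
  have "{x \<in> ?\<Omega>. x n = g} \<in> {{x \<in> ?\<Omega>. x n \<in> A} | n A. A \<subseteq> carrier G}" if "g \<in> carrier G" for n g
    using that by (intro CollectI exI[of _ n] exI[of _ "{g}"]) auto
  then show "sigma_sets ?\<Omega> ?\<A> \<subseteq> sets (trajectory_measure G \<mu>)"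
    unfolding gen by (intro sigma_sets_mono') auto
qed

lemma measurable_walk_trajectory:
  "walk G \<in> measurable increments (Pi\<^sub>M UNIV (\<lambda>_. count_space (carrier G)))"
proof (rule measurable_PiM_single')
  show "walk G \<in> space increments \<rightarrow> UNIV \<rightarrow>\<^sub>E space (count_space (carrier G))"
    by (auto simp: space_increments intro: walk_closed)
qed (rule measurable_walk)

text \<open>
  This holds for divergent sequences as well: \<open>lim\<close> is a description in terms of the limits of
  the sequence, and the two sequences, being equal up to a shift of time, have the same limits.
\<close>

lemma lim_trajectory_rel:
  fixes f :: "'g \<Rightarrow> real"
  assumes "(x, x') \<in> trajectory_rel G"
  shows "lim (\<lambda>n. f (x n)) = lim (\<lambda>n. f (x' n))"
proof -
  obtain i\<^sub>0 :: nat and k :: int where k: "\<And>i. i > i\<^sub>0 \<Longrightarrow> 0 \<le> int i + k \<and> x i = x' (nat (int i + k))"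
    using assms unfolding trajectory_rel_def by blast
  define m where "m = nat (int (Suc i\<^sub>0) + k)"
  have shift: "x (n + Suc i\<^sub>0) = x' (n + m)" for n
  proof -
    have "int m = int (Suc i\<^sub>0) + k"
      using k[of "Suc i\<^sub>0"] by (simp add: m_def)
    then have "nat (int (n + Suc i\<^sub>0) + k) = n + m" by linarith
    then show ?thesis using k[of "n + Suc i\<^sub>0"] by (simp only: zero_less_Suc less_add_same_cancel2 trans_less_add2 lessI)
  qed
  have "(\<lambda>n. f (x n)) \<longlonglongrightarrow> L \<longleftrightarrow> (\<lambda>n. f (x' n)) \<longlonglongrightarrow> L" for L
    using LIMSEQ_ignore_initial_segment[of "\<lambda>n. f (x n)" L "Suc i\<^sub>0"] LIMSEQ_offset[of "\<lambda>n. f (x n)" "Suc i\<^sub>0" L]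
      LIMSEQ_ignore_initial_segment[of "\<lambda>n. f (x' n)" L m] LIMSEQ_offset[of "\<lambda>n. f (x' n)" m L]
    unfolding shift by blast
  then show ?thesis by (simp add: lim_def)
qed

theorem poisson_boundary_nontrivial_if_limit:
  fixes f :: "'g \<Rightarrow> real"
  assumes conv: "AE y in increments. convergent (\<lambda>n. f (walk G y n))"
    and nonconst: "\<And>c. \<not> (AE y in increments. (\<lambda>n. f (walk G y n)) \<longlonglongrightarrow> c)"
  shows "poisson_boundary_nontrivial G \<mu>"
proof -
  let ?P = "trajectory_measure G \<mu>" and ?R = "trajectory_rel G"
  interpret P: prob_space ?P
    unfolding trajectory_measure_def
    by (rule increments.P.prob_space_distr[OF measurable_walk_trajectory])
  have space_P: "space ?P = UNIV \<rightarrow> carrier G"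
    by (simp add: trajectory_measure_def space_PiM PiE_def)
  have "\<exists>E. is_measurable_hull ?P ?R E"
  proof (rule P.measurable_hull_exists)
    show "countable ((\<lambda>(n, g). {x \<in> UNIV \<rightarrow> carrier G. x n = g}) ` ((UNIV :: nat set) \<times> carrier G))"
      using countable_carrier by auto
  qed (simp only: sets_trajectory_measure space_P)
  then have hull: "is_measurable_hull ?P ?R (measurable_hull ?P ?R)"
    unfolding measurable_hull_def by (rule someI_ex)
  define F where "F x = lim (\<lambda>n. f (x n))" for x
  have F_meas: "F \<in> borel_measurable ?P"
    unfolding F_def
  proof (rule borel_measurable_lim_metric)
    fix n
    have "(\<lambda>x. x n) \<in> measurable ?P (count_space (carrier G))"
      unfolding trajectory_measure_def by measurable
    then show "(\<lambda>x. f (x n)) \<in> borel_measurable ?P"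
      by (rule measurable_compose) simp
  qed
  have F_inv: "F x = F x'" if "(x, x') \<in> ?R" for x x'
    unfolding F_def using that by (rule lim_trajectory_rel)
  have F_nonconst: "\<not> (AE x in ?P. F x = c)" for c
  proof
    assume "AE x in ?P. F x = c"
    then have "AE y in increments. F (walk G y) = c"
      unfolding trajectory_measure_def by (rule AE_distrD[OF measurable_walk_trajectory])
    with conv have "AE y in increments. (\<lambda>n. f (walk G y n)) \<longlonglongrightarrow> c"
      by eventually_elim (auto simp: F_def convergent_LIMSEQ_iff)
    then show False using nonconst by blast
  qed
  have "\<not> single_point_mod0 (quotient_measure ?P (measurable_hull ?P ?R))"
    by (rule P.quotient_by_hull_not_single_point[OF hull, where f = F]) (fact F_meas F_inv F_nonconst)+
  then show ?thesis
    unfolding poisson_boundary_nontrivial_def poisson_boundary_def Let_def .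
qed

end

section \<open>Length functions and the first moment\<close>

context group
begin

lemma foldr_mult_closed: "set w \<subseteq> carrier G \<Longrightarrow> foldr (\<otimes>) w \<one> \<in> carrier G"
  by (induction w) auto

lemma foldr_mult_append:
  "set u \<subseteq> carrier G \<Longrightarrow> set w \<subseteq> carrier G \<Longrightarrow>
    foldr (\<otimes>) (u @ w) \<one> = foldr (\<otimes>) u \<one> \<otimes> foldr (\<otimes>) w \<one>"
  by (induction u) (auto simp: m_assoc foldr_mult_closed simp del: foldr_append)

lemma word_in_generate:
  assumes S: "S \<subseteq> carrier G" and "g \<in> generate G S"
  shows "\<exists>w. set w \<subseteq> S \<union> m_inv G ` S \<and> foldr (\<otimes>) w \<one> = g"
  using assms(2)
proof (induction rule: generate.induct)
  case one
  then show ?case by (intro exI[of _ "[]"]) simp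
next
  case (incl h)
  then show ?case using S by (intro exI[of _ "[h]"]) auto
next
  case (inv h)
  then show ?case using S by (intro exI[of _ "[inv h]"]) auto
next
  case (eng g h)
  then obtain u w where u: "set u \<subseteq> S \<union> m_inv G ` S" "foldr (\<otimes>) u \<one> = g"
    and w: "set w \<subseteq> S \<union> m_inv G ` S" "foldr (\<otimes>) w \<one> = h" by blast
  have "S \<union> m_inv G ` S \<subseteq> carrier G" using S by auto
  then have "foldr (\<otimes>) (u @ w) \<one> = g \<otimes> h"
    using foldr_mult_append[OF order_trans[OF u(1)] order_trans[OF w(1)]] u(2) w(2) by simp
  moreover have "set (u @ w) \<subseteq> S \<union> m_inv G ` S" using u(1) w(1) by simp
  ultimately show ?case by (intro exI[of _ "u @ w"] conjI)
qed

lemma countable_semigroup_generate: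
  assumes A: "A \<subseteq> carrier G" "countable A"
  shows "countable (semigroup_generate G A)"
proof -
  have "\<exists>w\<in>lists A. foldr (\<otimes>) w \<one> = g" if "g \<in> semigroup_generate G A" for g
    using that
  proof (induction rule: semigroup_generate.induct)
    case (incl a)
    then show ?case using A by (intro bexI[of _ "[a]"]) auto
  next
    case (mult g h)
    then obtain u w where uw: "u \<in> lists A" "foldr (\<otimes>) u \<one> = g" "w \<in> lists A" "foldr (\<otimes>) w \<one> = h" by blast
    then have "set u \<subseteq> carrier G" "set w \<subseteq> carrier G" using A by auto
    then show ?case using uw foldr_mult_append[of u w] by (intro bexI[of _ "u @ w"]) auto
  qed
  then have "semigroup_generate G A \<subseteq> (\<lambda>w. foldr (\<otimes>) w \<one>) ` lists A" by blast
  moreover have "countable (lists A)" using A(2) by (rule countable_lists)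
  ultimately show ?thesis by (meson countable_image countable_subset)
qed

lemma subadditive_le_word_length:
  fixes L :: "'a \<Rightarrow> ennreal"
  assumes S: "S \<subseteq> carrier G" "generate G S = carrier G" and g: "g \<in> carrier G"
    and L: "L \<one> = 0" "\<And>g h. g \<in> carrier G \<Longrightarrow> h \<in> carrier G \<Longrightarrow> L (g \<otimes> h) \<le> L g + L h"
    and c: "\<And>s. s \<in> S \<union> m_inv G ` S \<Longrightarrow> L s \<le> c"
  shows "L g \<le> c * of_nat (word_length G S g)"
proof -
  let ?P = "\<lambda>n. \<exists>w. length w = n \<and> set w \<subseteq> S \<union> m_inv G ` S \<and> foldr (\<otimes>) w \<one> = g"
  have "\<exists>n. ?P n" using word_in_generate[OF S(1), of g] S(2) g by blast
  then have "?P (LEAST n. ?P n)" by (rule LeastI_ex)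
  then obtain w where w: "length w = word_length G S g" "set w \<subseteq> S \<union> m_inv G ` S" "foldr (\<otimes>) w \<one> = g"
    unfolding word_length_def by blast
  have "L (foldr (\<otimes>) u \<one>) \<le> c * of_nat (length u)" if "set u \<subseteq> S \<union> m_inv G ` S" for u
    using that
  proof (induction u)
    case (Cons s u)
    have "set (s # u) \<subseteq> carrier G" using Cons.prems S(1) by auto
    then have "L (foldr (\<otimes>) (s # u) \<one>) \<le> L s + L (foldr (\<otimes>) u \<one>)"
      using foldr_mult_closed[of u] L(2)[of s "foldr (\<otimes>) u \<one>"] by auto
    also have "\<dots> \<le> c + c * of_nat (length u)"
      using Cons c[of s] by (intro add_mono) auto
    finally show ?case by (simp add: distrib_left)
  qed (simp add: L(1))
  from this[OF w(2)] show ?thesis using w by simp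
qed

end

context random_action
begin

lemma nn_integral_\<mu>:
  "(\<integral>\<^sup>+ g. f g \<partial>\<mu>) = (\<integral>\<^sup>+ g. ennreal (measure \<mu> {g}) * f g \<partial>count_space (carrier G))"
proof -
  have "\<mu> = density (count_space (carrier G)) (\<lambda>g. ennreal (measure \<mu> {g}))"
  proof (rule measure_eqI_countable[where A = "carrier G"])
    fix a assume "a \<in> carrier G"
    then show "emeasure \<mu> {a} = emeasure (density (count_space (carrier G)) (\<lambda>g. ennreal (measure \<mu> {g}))) {a}"
      by (simp add: emeasure_density nn_integral_indicator_singleton emeasure_eq_measure)
  qed (simp_all add: sets_\<mu> countable_carrier)
  then have "(\<integral>\<^sup>+ g. f g \<partial>\<mu>) = (\<integral>\<^sup>+ g. f g \<partial>density (count_space (carrier G)) (\<lambda>g. ennreal (measure \<mu> {g})))"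
    by (rule arg_cong)
  then show ?thesis by (simp add: nn_integral_density)
qed

lemma subadditive_integrable:
  fixes L :: "'g \<Rightarrow> ennreal"
  assumes moment: "finite_first_moment G \<mu>"
    and L: "L \<one> = 0" "\<And>g h. g \<in> carrier G \<Longrightarrow> h \<in> carrier G \<Longrightarrow> L (g \<otimes> h) \<le> L g + L h"
    and fin: "\<And>g. g \<in> carrier G \<Longrightarrow> L g < \<infinity>"
  shows "(\<integral>\<^sup>+ g. L g \<partial>\<mu>) < \<infinity>"
proof -
  obtain S where S: "finite S" "S \<subseteq> carrier G" "generate G S = carrier G"
    and sum: "(\<lambda>g. real (word_length G S g) * measure \<mu> {g}) summable_on carrier G"
    using moment unfolding finite_first_moment_def by blast
  let ?T = "S \<union> m_inv G ` S"
  have T: "finite ?T" "?T \<subseteq> carrier G" using S by auto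
  define c where "c = (\<Sum>s\<in>?T. L s)"
  have c: "L s \<le> c" if "s \<in> ?T" for s
    unfolding c_def using T(1) that by (intro member_le_sum) auto
  have "c < \<infinity>" unfolding c_def using T fin by (auto simp: less_top[symmetric])
  have int: "integrable (count_space (carrier G)) (\<lambda>g. real (word_length G S g) * measure \<mu> {g})"
    using sum[THEN summable_on_iff_abs_summable_on_real[THEN iffD1], THEN abs_summable_equivalent[THEN iffD1]]
    unfolding Infinite_Set_Sum.abs_summable_on_def .
  have "(\<integral>\<^sup>+ g. L g \<partial>\<mu>) \<le> (\<integral>\<^sup>+ g. c * ennreal (word_length G S g) \<partial>\<mu>)"
    using subadditive_le_word_length[OF S(2,3) _ L c]
    by (intro nn_integral_mono) (auto simp: space_\<mu> ennreal_of_nat_eq_real_of_nat)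
  also have "\<dots> = c * (\<integral>\<^sup>+ g. ennreal (word_length G S g) \<partial>\<mu>)"
    by (simp add: nn_integral_cmult)
  also have "(\<integral>\<^sup>+ g. ennreal (word_length G S g) \<partial>\<mu>) =
      (\<integral>\<^sup>+ g. ennreal (real (word_length G S g) * measure \<mu> {g}) \<partial>count_space (carrier G))"
    by (simp add: nn_integral_\<mu> ennreal_mult mult.commute)
  also have "c * \<dots> < \<infinity>"
    using int \<open>c < \<infinity>\<close> by (simp add: ennreal_mult_less_top nn_integral_eq_integral)
  finally show ?thesis .
qed

text \<open>
  The sum of \<open>\<bar>C g v\<bar>\<close> over \<open>X\<close> is subadditive in \<open>g\<close>, again because \<open>G\<close> permutes
  \<open>X\<close>; hence it grows at most linearly in the word length.
\<close>

lemma cocycle_moment: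
  fixes C :: "'g \<Rightarrow> 'x \<Rightarrow> real"
  assumes moment: "finite_first_moment G \<mu>"
    and cocycle: "\<And>g h v. g \<in> carrier G \<Longrightarrow> h \<in> carrier G \<Longrightarrow> v \<in> X \<Longrightarrow> C (g \<otimes> h) v = C g (act h v) + C h v"
    and finite_support: "\<And>g. g \<in> carrier G \<Longrightarrow> finite {v \<in> X. C g v \<noteq> 0}"
  shows "(\<integral>\<^sup>+ g. (\<integral>\<^sup>+ v. ennreal \<bar>C g v\<bar> \<partial>count_space X) \<partial>\<mu>) < \<infinity>"
proof (rule subadditive_integrable[OF moment])
  have "C \<one> v = 0" if "v \<in> X" for v using cocycle[of \<one> \<one> v] that by (simp add: act_one)
  then have "(\<integral>\<^sup>+ v. ennreal \<bar>C \<one> v\<bar> \<partial>count_space X) = (\<integral>\<^sup>+ v. 0 \<partial>count_space X)"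
    by (intro nn_integral_cong) simp
  then show "(\<integral>\<^sup>+ v. ennreal \<bar>C \<one> v\<bar> \<partial>count_space X) = 0" by simp
next
  fix g h assume gh: "g \<in> carrier G" "h \<in> carrier G"
  have "(\<integral>\<^sup>+ v. ennreal \<bar>C (g \<otimes> h) v\<bar> \<partial>count_space X)
      \<le> (\<integral>\<^sup>+ v. ennreal \<bar>C g (act h v)\<bar> + ennreal \<bar>C h v\<bar> \<partial>count_space X)"
    using gh by (intro nn_integral_mono) (simp add: cocycle ennreal_leI flip: ennreal_plus)
  also have "\<dots> = (\<integral>\<^sup>+ v. ennreal \<bar>C g (act h v)\<bar> \<partial>count_space X) + (\<integral>\<^sup>+ v. ennreal \<bar>C h v\<bar> \<partial>count_space X)"
    by (simp add: nn_integral_add)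
  also have "(\<integral>\<^sup>+ v. ennreal \<bar>C g (act h v)\<bar> \<partial>count_space X) = (\<integral>\<^sup>+ v. ennreal \<bar>C g v\<bar> \<partial>count_space X)"
    by (rule nn_integral_act[OF gh(2)])
  finally show "(\<integral>\<^sup>+ v. ennreal \<bar>C (g \<otimes> h) v\<bar> \<partial>count_space X)
      \<le> (\<integral>\<^sup>+ v. ennreal \<bar>C g v\<bar> \<partial>count_space X) + (\<integral>\<^sup>+ v. ennreal \<bar>C h v\<bar> \<partial>count_space X)" .
next
  fix g assume "g \<in> carrier G"
  then have "(\<integral>\<^sup>+ v. ennreal \<bar>C g v\<bar> \<partial>count_space X) = (\<Sum>v\<in>{v \<in> X. C g v \<noteq> 0}. ennreal \<bar>C g v\<bar>)"
    using finite_support by (intro nn_integral_count_space') auto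
  then show "(\<integral>\<^sup>+ v. ennreal \<bar>C g v\<bar> \<partial>count_space X) < \<infinity>" by (simp add: sum_ennreal)
qed

end

section \<open>Thompson's group\<close>

lemma dyadicI: "x = of_int m / 2 ^ n \<Longrightarrow> x \<in> dyadic"
  by (auto simp: dyadic_def)

lemma dyadic_add:
  assumes "x \<in> dyadic" "y \<in> dyadic"
  shows "x + y \<in> dyadic"
proof -
  from assms obtain m n :: int and i j :: nat where xy: "x = of_int m / 2 ^ i" "y = of_int n / 2 ^ j"
    by (auto simp: dyadic_def)
  have "x + y = of_int (m * 2 ^ j + n * 2 ^ i) / 2 ^ (i + j)"
    unfolding xy by (simp add: field_simps power_add)
  then show ?thesis by (rule dyadicI)
qed

lemma dyadic_mult:
  assumes "x \<in> dyadic" "y \<in> dyadic"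
  shows "x * y \<in> dyadic"
proof -
  from assms obtain m n :: int and i j :: nat where "x = of_int m / 2 ^ i" "y = of_int n / 2 ^ j"
    by (auto simp: dyadic_def)
  then have "x * y = of_int (m * n) / 2 ^ (i + j)" by (simp add: power_add)
  then show ?thesis by (rule dyadicI)
qed

lemma dyadic_of_int: "of_int m \<in> dyadic"
  by (rule dyadicI[of _ m 0]) simp

lemma dyadic_powi: "2 powi k \<in> dyadic"
proof (cases "0 \<le> k")
  case True
  then show ?thesis using dyadic_of_int[of "2 ^ nat k"] by (simp add: power_int_def)
next
  case False
  then show ?thesis by (intro dyadicI[of _ 1 "nat (- k)"]) (simp add: power_int_def inverse_eq_divide power_divide)
qed

lemma dyadic_diff: "x \<in> dyadic \<Longrightarrow> y \<in> dyadic \<Longrightarrow> x - y \<in> dyadic"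
  using dyadic_add[of x "of_int (- 1) * y"] dyadic_mult[OF dyadic_of_int, of y "- 1"] by simp

definition affine_off :: "real set \<Rightarrow> (real \<Rightarrow> real) \<Rightarrow> bool" where
  "affine_off B f \<longleftrightarrow> (\<forall>a b. 0 \<le> a \<and> a < b \<and> b \<le> 1 \<and> {a<..<b} \<inter> B = {} \<longrightarrow>
     (\<exists>k::int. \<forall>x\<in>{a..b}. f x = f a + 2 powi k * (x - a)))"

lemma affine_offD:
  assumes "affine_off B f" "0 \<le> a" "a < b" "b \<le> 1" "{a<..<b} \<inter> B = {}"
  obtains k :: int where "\<And>x. x \<in> {a..b} \<Longrightarrow> f x = f a + 2 powi k * (x - a)"
  using assms unfolding affine_off_def by blast

text \<open>
  A strictly increasing continuous function fixing both end points is a homeomorphism of the interval.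
\<close>

lemma thompson_homeoI:
  assumes ext: "f \<in> extensional {0..1}" and cont: "continuous_on {0..1} f" and mono: "strict_mono_on {0..1} f"
    and ends: "f 0 = 0" "f 1 = 1"
    and B: "finite B" "B \<subseteq> dyadic" "affine_off B f"
  shows "thompson_homeo f"
proof -
  have inj: "inj_on f {0..1}" using mono by (rule strict_mono_on_imp_inj_on)
  have image: "f ` {0..1} = {0..1}"
  proof
    show "f ` {0..1} \<subseteq> {0..1}"
      using strict_mono_on_leD[OF mono, of 0] strict_mono_on_leD[OF mono, of _ 1] ends by force
    obtain c d where "f ` {0..1} = {c..d}"
      using continuous_image_closed_interval[OF _ cont] by auto
    moreover have "0 \<in> f ` {0..1}" "1 \<in> f ` {0..1}" using ends by (auto intro: image_eqI[of 0 f 0] image_eqI[of 1 f 1])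
    ultimately show "{0..1} \<subseteq> f ` {0..1}" by auto
  qed
  obtain g where "homeomorphism {0..1} {0..1} f g"
    using homeomorphism_compact[OF _ cont image inj] by auto
  moreover have "f \<in> Bij {0..1}"
    using ext inj image by (simp add: Bij_def bij_betw_def)
  ultimately show ?thesis
    unfolding thompson_homeo_def using mono B affine_off_def[of B f] by blast
qed

lemma thompson_homeoE:
  assumes "thompson_homeo f"
  obtains B where "finite B" "B \<subseteq> dyadic" "affine_off B f"
  using assms unfolding thompson_homeo_def affine_off_def by blast

lemma thompson_homeoD:
  assumes "thompson_homeo f"
  shows thompson_Bij: "f \<in> Bij {0..1}" and thompson_mono: "strict_mono_on {0..1} f"
    and thompson_bij_betw: "bij_betw f {0..1} {0..1}"
    and thompson_continuous: "continuous_on {0..1} f"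
  using assms by (auto simp: thompson_homeo_def Bij_def homeomorphism_def)

lemma thompson_closed: "thompson_homeo f \<Longrightarrow> x \<in> {0..1} \<Longrightarrow> f x \<in> {0..1}"
  using thompson_bij_betw bij_betwE by blast

lemma thompson_less_iff:
  "thompson_homeo f \<Longrightarrow> x \<in> {0..1} \<Longrightarrow> y \<in> {0..1} \<Longrightarrow> f x < f y \<longleftrightarrow> x < y"
  by (rule strict_mono_on_less[OF thompson_mono])

lemma thompson_le_iff:
  "thompson_homeo f \<Longrightarrow> x \<in> {0..1} \<Longrightarrow> y \<in> {0..1} \<Longrightarrow> f x \<le> f y \<longleftrightarrow> x \<le> y"
  by (rule strict_mono_on_less_eq[OF thompson_mono])

lemma thompson_ends:
  assumes "thompson_homeo f"
  shows "f 0 = 0" "f 1 = 1"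
proof -
  have surj: "f ` {0..1} = {0..1}" using thompson_bij_betw[OF assms] by (simp add: bij_betw_def)
  have "0 \<in> f ` {0..1}" "1 \<in> f ` {0..1}" unfolding surj by auto
  then obtain x y where x: "x \<in> {0..1}" "f x = 0" and y: "y \<in> {0..1}" "f y = 1" by (metis imageE)
  have "f 0 \<le> f x" "f y \<le> f 1" using x y thompson_le_iff[OF assms, of 0 x] thompson_le_iff[OF assms, of y 1] by auto
  moreover have "f 0 \<in> {0..1}" "f 1 \<in> {0..1}" using thompson_closed[OF assms] by auto
  ultimately show "f 0 = 0" "f 1 = 1" using x y by auto
qed

text \<open>
  Needed for inverses, whose break points are the images of the original ones. The induction
  goes from one break point to the next.
\<close>

lemma thompson_dyadic:
  assumes f: "thompson_homeo f" and x: "x \<in> dyadic" "x \<in> {0..1}"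
  shows "f x \<in> dyadic"
proof -
  obtain B where B: "finite B" "B \<subseteq> dyadic" "affine_off B f" using f by (rule thompson_homeoE)
  show ?thesis
    using x
  proof (induction "card (B \<inter> {0<..<x})" arbitrary: x rule: less_induct)
    case less
    show ?case
    proof (cases "x = 0")
      case True
      then show ?thesis using thompson_ends[OF f] dyadic_of_int[of 0] by simp
    next
      case False
      \<comment> \<open>\<open>f\<close> is affine between \<open>x\<close> and the break point \<open>c\<close> (or end point \<open>0\<close>) preceding it.\<close>
      define c where "c = (if B \<inter> {0<..<x} = {} then 0 else Max (B \<inter> {0<..<x}))"
      have fin: "finite (B \<inter> {0<..<x})" using B by simp
      have c: "c \<in> dyadic \<and> f c \<in> dyadic \<and> 0 \<le> c \<and> c < x \<and> {c<..<x} \<inter> B = {}"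
      proof (cases "B \<inter> {0<..<x} = {}")
        case True
        then show ?thesis
          using thompson_ends[OF f] dyadic_of_int[of 0] False less.prems by (auto simp: c_def)
      next
        case ne: False
        then have c_in: "c \<in> B \<inter> {0<..<x}" using Max_in[OF fin] by (simp add: c_def)
        have c_max: "y \<le> c" if "y \<in> B \<inter> {0<..<x}" for y using Max_ge[OF fin that] ne by (simp add: c_def)
        have "B \<inter> {0<..<c} \<subset> B \<inter> {0<..<x}" using c_in by auto
        then have "card (B \<inter> {0<..<c}) < card (B \<inter> {0<..<x})" by (rule psubset_card_mono[OF fin])
        then have "f c \<in> dyadic" using less c_in B by auto
        then show ?thesis
          using c_in c_max B by fastforce
      qed
      have "x \<le> 1" using less.prems by simp
      with c obtain k where k: "\<And>y. y \<in> {c..x} \<Longrightarrow> f y = f c + 2 powi k * (y - c)"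
        using affine_offD[OF B(3), of c x] by blast
      have "f x = f c + 2 powi k * (x - c)" using c by (intro k) simp
      then show ?thesis using c less.prems by (simp add: dyadic_add dyadic_mult dyadic_diff dyadic_powi)
    qed
  qed
qed

definition thompson_inverse :: "(real \<Rightarrow> real) \<Rightarrow> real \<Rightarrow> real" where
  "thompson_inverse f = restrict (inv_into {0..1} f) {0..1}"

lemma thompson_inverse_eq:
  assumes "thompson_homeo f" "x \<in> {0..1}"
  shows "f (thompson_inverse f x) = x" "thompson_inverse f (f x) = x" "thompson_inverse f x \<in> {0..1}"
  using assms thompson_bij_betw[OF assms(1)] thompson_closed[OF assms]
  by (auto simp: thompson_inverse_def bij_betw_inv_into_left bij_betw_inv_into_right
      intro: bij_betw_apply[OF bij_betw_inv_into, of f "{0..1}" "{0..1}"] simp del: atLeastAtMost_iff)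

lemma thompson_homeo_inverse:
  assumes f: "thompson_homeo f"
  shows "thompson_homeo (thompson_inverse f)"
proof -
  let ?g = "thompson_inverse f"
  note g = thompson_inverse_eq[OF f]
  obtain B where B: "finite B" "B \<subseteq> dyadic" "affine_off B f" using f by (rule thompson_homeoE)
  obtain h where h: "homeomorphism {0..1} {0..1} f h" using f by (auto simp: thompson_homeo_def)
  have "h x = ?g x" if "x \<in> {0..1}" for x
    using h that g by (metis homeomorphism_apply1)
  then have "continuous_on {0..1} ?g"
    by (rule continuous_on_eq[OF homeomorphism_cont2[OF h]])
  moreover have less_iff: "?g x < ?g y \<longleftrightarrow> x < y" if "x \<in> {0..1}" "y \<in> {0..1}" for x y
    using thompson_less_iff[OF f g(3)[OF that(1)] g(3)[OF that(2)]] that by (simp add: g(1))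
  then have "strict_mono_on {0..1} ?g" by (auto intro: strict_mono_onI)
  moreover have "affine_off (f ` (B \<inter> {0..1})) ?g"
    unfolding affine_off_def
  proof (intro allI impI)
    fix a b :: real assume ab: "0 \<le> a \<and> a < b \<and> b \<le> 1 \<and> {a<..<b} \<inter> f ` (B \<inter> {0..1}) = {}"
    then have I: "a \<in> {0..1}" "b \<in> {0..1}" by auto
    have "{?g a<..<?g b} \<inter> B = {}"
    proof (rule ccontr)
      assume "{?g a<..<?g b} \<inter> B \<noteq> {}"
      then obtain \<beta> where \<beta>: "\<beta> \<in> B" "?g a < \<beta>" "\<beta> < ?g b" by auto
      have \<beta>I: "\<beta> \<in> {0..1}" using \<beta> g(3)[OF I(1)] g(3)[OF I(2)] by auto
      have "a < f \<beta>" "f \<beta> < b"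
        using \<beta> thompson_less_iff[OF f g(3)[OF I(1)] \<beta>I] thompson_less_iff[OF f \<beta>I g(3)[OF I(2)]] by (simp_all add: g(1)[OF I(1)] g(1)[OF I(2)])
      then have "f \<beta> \<in> {a<..<b} \<inter> f ` (B \<inter> {0..1})" using \<beta>(1) \<beta>I by (intro IntI imageI) simp_all
      with ab show False by (metis emptyE)
    qed
    moreover have "?g a < ?g b" using less_iff[OF I] ab by simp
    moreover have "0 \<le> ?g a" "?g b \<le> 1" using g(3)[OF I(1)] g(3)[OF I(2)] by simp_all
    ultimately obtain k where k: "\<And>x. x \<in> {?g a..?g b} \<Longrightarrow> f x = f (?g a) + 2 powi k * (x - ?g a)"
      using affine_offD[OF B(3), of "?g a" "?g b"] by blast
    have "?g y = ?g a + 2 powi (- k) * (y - a)" if y: "y \<in> {a..b}" for y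
    proof -
      have yI: "y \<in> {0..1}" using y I by auto
      have "?g y \<in> {?g a..?g b}" using less_iff[OF yI I(1)] less_iff[OF I(2) yI] y by auto
      from k[OF this] have "y = a + 2 powi k * (?g y - ?g a)" by (simp only: g(1)[OF yI] g(1)[OF I(1)])
      then show ?thesis by (simp add: power_int_minus field_simps)
    qed
    then show "\<exists>k::int. \<forall>x\<in>{a..b}. ?g x = ?g a + 2 powi k * (x - a)" by blast
  qed
  moreover have "f ` (B \<inter> {0..1}) \<subseteq> dyadic" using thompson_dyadic[OF f] B by auto
  moreover have "?g 0 = 0" "?g 1 = 1" using g(2)[of 0] g(2)[of 1] thompson_ends[OF f] by auto
  ultimately show ?thesis
    using B(1) by (intro thompson_homeoI[of ?g "f ` (B \<inter> {0..1})"]) (auto simp: thompson_inverse_def)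
qed

lemma thompson_homeo_compose:
  assumes f: "thompson_homeo f" and h: "thompson_homeo h"
  shows "thompson_homeo (compose {0..1} f h)"
proof -
  let ?fh = "compose {0..1} f h" and ?k = "thompson_inverse h"
  have fh: "?fh x = f (h x)" if "x \<in> {0..1}" for x using that by (simp add: compose_def)
  obtain A where A: "finite A" "A \<subseteq> dyadic" "affine_off A f" using f by (rule thompson_homeoE)
  obtain B where B: "finite B" "B \<subseteq> dyadic" "affine_off B h" using h by (rule thompson_homeoE)
  let ?C = "B \<union> ?k ` (A \<inter> {0..1})"
  have "continuous_on {0..1} (\<lambda>x. f (h x))"
    using thompson_bij_betw[OF h]
    by (intro continuous_on_compose2[OF thompson_continuous[OF f] thompson_continuous[OF h]]) (auto simp: bij_betw_def)
  then have "continuous_on {0..1} ?fh" by (rule continuous_on_eq) (simp add: fh)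
  moreover have "strict_mono_on {0..1} ?fh"
    using thompson_less_iff[OF f thompson_closed[OF h] thompson_closed[OF h]] thompson_less_iff[OF h]
    by (intro strict_mono_onI) (simp add: fh)
  moreover have "affine_off ?C ?fh"
    unfolding affine_off_def
  proof (intro allI impI)
    fix a b :: real assume ab: "0 \<le> a \<and> a < b \<and> b \<le> 1 \<and> {a<..<b} \<inter> ?C = {}"
    then have I: "a \<in> {0..1}" "b \<in> {0..1}" by auto
    have "{a<..<b} \<inter> B = {}" using ab by blast
    with ab obtain k where k: "\<And>x. x \<in> {a..b} \<Longrightarrow> h x = h a + 2 powi k * (x - a)"
      using affine_offD[OF B(3), of a b] by blast
    have "{h a<..<h b} \<inter> A = {}"
    proof (rule ccontr)
      assume "{h a<..<h b} \<inter> A \<noteq> {}"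
      then obtain \<beta> where \<beta>: "\<beta> \<in> A" "h a < \<beta>" "\<beta> < h b" by auto
      have \<beta>I: "\<beta> \<in> {0..1}" using \<beta> thompson_closed[OF h I(1)] thompson_closed[OF h I(2)] by auto
      note k\<beta> = thompson_inverse_eq[OF h \<beta>I]
      have "a < ?k \<beta>" "?k \<beta> < b"
        using \<beta> thompson_less_iff[OF h I(1) k\<beta>(3)] thompson_less_iff[OF h k\<beta>(3) I(2)] by (simp_all add: k\<beta>(1))
      then have "?k \<beta> \<in> {a<..<b} \<inter> ?C" using \<beta>(1) \<beta>I by (intro IntI UnI2 imageI) simp_all
      with ab show False by (metis emptyE)
    qed
    moreover have "h a < h b" using thompson_less_iff[OF h I] ab by simp
    moreover have "0 \<le> h a" "h b \<le> 1" using thompson_closed[OF h I(1)] thompson_closed[OF h I(2)] by simp_all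
    ultimately obtain l where l: "\<And>x. x \<in> {h a..h b} \<Longrightarrow> f x = f (h a) + 2 powi l * (x - h a)"
      using affine_offD[OF A(3), of "h a" "h b"] by blast
    have "?fh x = ?fh a + 2 powi (l + k) * (x - a)" if x: "x \<in> {a..b}" for x
    proof -
      have xI: "x \<in> {0..1}" using x I by auto
      have "h x \<in> {h a..h b}" using thompson_le_iff[OF h I(1) xI] thompson_le_iff[OF h xI I(2)] x by auto
      then have "f (h x) = f (h a) + 2 powi l * (h x - h a)" by (rule l)
      moreover have "h x - h a = 2 powi k * (x - a)" using k[OF x] by simp
      ultimately show ?thesis by (simp add: fh I xI power_int_add del: atLeastAtMost_iff)
    qed
    then show "\<exists>k::int. \<forall>x\<in>{a..b}. ?fh x = ?fh a + 2 powi k * (x - a)" by blast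
  qed
  moreover have "?k ` (A \<inter> {0..1}) \<subseteq> dyadic"
    using thompson_dyadic[OF thompson_homeo_inverse[OF h]] A by auto
  ultimately show ?thesis
    using A(1) B(1,2) thompson_ends[OF f] thompson_ends[OF h]
    by (intro thompson_homeoI[of ?fh ?C]) (auto simp: fh)
qed

lemma thompson_homeo_id: "thompson_homeo (restrict (\<lambda>x. x) {0..1})"
proof (rule thompson_homeoI[of _ "{}"])
  show "affine_off {} (restrict (\<lambda>x. x) {0..1})"
    unfolding affine_off_def by (intro allI impI exI[of _ 0]) auto
  show "continuous_on {0..1} (restrict (\<lambda>x. x) {0..1 :: real})"
    by (rule continuous_on_eq[OF continuous_on_id]) simp
qed (auto intro: strict_mono_onI)

lemma carrier_thompson: "carrier thompson_F = {f. thompson_homeo f}"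
  by (simp add: thompson_F_def)

lemma thompson_one: "\<one>\<^bsub>thompson_F\<^esub> = restrict (\<lambda>x. x) {0..1}"
  by (simp add: thompson_F_def BijGroup_def)

lemma thompson_mult:
  "thompson_homeo f \<Longrightarrow> thompson_homeo h \<Longrightarrow> f \<otimes>\<^bsub>thompson_F\<^esub> h = compose {0..1} f h"
  by (simp add: thompson_F_def BijGroup_def thompson_Bij)

lemma group_thompson: "group thompson_F"
proof -
  have "subgroup {f. thompson_homeo f} (BijGroup {0..1})"
  proof (rule subgroup.intro)
    show "{f. thompson_homeo f} \<subseteq> carrier (BijGroup {0..1})"
      by (auto simp: BijGroup_def thompson_Bij)
    show "f \<otimes>\<^bsub>BijGroup {0..1}\<^esub> h \<in> {f. thompson_homeo f}"
      if "f \<in> {f. thompson_homeo f}" "h \<in> {f. thompson_homeo f}" for f h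
      using that by (simp add: BijGroup_def thompson_Bij thompson_homeo_compose)
    show "\<one>\<^bsub>BijGroup {0..1}\<^esub> \<in> {f. thompson_homeo f}"
      using thompson_homeo_id by (simp add: BijGroup_def)
    show "inv\<^bsub>BijGroup {0..1}\<^esub> f \<in> {f. thompson_homeo f}" if "f \<in> {f. thompson_homeo f}" for f
      using that thompson_homeo_inverse[of f]
      by (simp add: inv_BijGroup[OF thompson_Bij] thompson_inverse_def)
  qed
  then show ?thesis
    unfolding thompson_F_def by (rule subgroup.subgroup_is_group) (rule group_BijGroup)
qed

section \<open>The jump of the logarithmic slope\<close>

text \<open>
  The slope on the right of \<open>v\<close> for \<open>\<sigma> = 1\<close>, on the left for \<open>\<sigma> = - 1\<close>. The factor \<open>\<sigma>\<close>
  occurs on both sides so that increasing functions have positive slopes in either direction.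
\<close>

definition side_slope :: "real \<Rightarrow> (real \<Rightarrow> real) \<Rightarrow> real \<Rightarrow> real" where
  "side_slope \<sigma> f v = (THE r. \<exists>e>0. \<forall>t\<in>{0..e}. f (v + \<sigma> * t) = f v + \<sigma> * (r * t))"

definition log_jump :: "(real \<Rightarrow> real) \<Rightarrow> real \<Rightarrow> real" where
  "log_jump f v = ln (side_slope 1 f v) - ln (side_slope (- 1) f v)"

lemma side_slope_eqI:
  assumes "\<sigma> \<noteq> 0" "e > 0" and slope: "\<And>t. t \<in> {0..e} \<Longrightarrow> f (v + \<sigma> * t) = f v + \<sigma> * (r * t)"
  shows "side_slope \<sigma> f v = r"
  unfolding side_slope_def
proof (rule the_equality)
  show "\<exists>e>0. \<forall>t\<in>{0..e}. f (v + \<sigma> * t) = f v + \<sigma> * (r * t)" using assms by blast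
next
  fix r' assume "\<exists>e>0. \<forall>t\<in>{0..e}. f (v + \<sigma> * t) = f v + \<sigma> * (r' * t)"
  then obtain e' where e': "e' > 0" "\<And>t. t \<in> {0..e'} \<Longrightarrow> f (v + \<sigma> * t) = f v + \<sigma> * (r' * t)" by blast
  define t where "t = min e e'"
  have t: "t > 0" "t \<in> {0..e}" "t \<in> {0..e'}" using \<open>e > 0\<close> e'(1) by (auto simp: t_def)
  have "f v + \<sigma> * (r * t) = f v + \<sigma> * (r' * t)" by (rule trans[OF slope[OF t(2), symmetric] e'(2)[OF t(3)]])
  then show "r' = r" using \<open>\<sigma> \<noteq> 0\<close> t(1) by simp
qed

lemma finite_gap_around:
  fixes v :: real
  assumes "finite B" "0 < v" "v < 1"
  obtains e where "e > 0" "0 \<le> v - e" "v + e \<le> 1" "{v - e<..<v + e} \<inter> B \<subseteq> {v}"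
proof -
  obtain d where d: "d > 0" "\<forall>x\<in>B. x \<noteq> v \<longrightarrow> d \<le> dist v x"
    using finite_set_avoid[OF assms(1), of v] by blast
  define e where "e = min d (min v (1 - v))"
  have "{v - e<..<v + e} \<inter> B \<subseteq> {v}"
  proof
    fix x assume x: "x \<in> {v - e<..<v + e} \<inter> B"
    then have "dist v x < d" by (auto simp: dist_real_def e_def)
    then show "x \<in> {v}" using d x by force
  qed
  then show ?thesis using d assms by (intro that[of e]) (auto simp: e_def)
qed

lemma side_slope_exists:
  assumes f: "thompson_homeo f" and v: "0 < v" "v < 1" and \<sigma>: "\<sigma> = 1 \<or> \<sigma> = - 1"
  obtains r e where "r > 0" "e > 0" "0 \<le> v - e" "v + e \<le> 1"
    "\<And>t. t \<in> {0..e} \<Longrightarrow> f (v + \<sigma> * t) = f v + \<sigma> * (r * t)"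
proof -
  obtain B where B: "finite B" "B \<subseteq> dyadic" "affine_off B f" using f by (rule thompson_homeoE)
  obtain e where e: "e > 0" "0 \<le> v - e" "v + e \<le> 1" "{v - e<..<v + e} \<inter> B \<subseteq> {v}"
    by (rule finite_gap_around[OF B(1) v])
  have "{v<..<v + e} \<subseteq> {v - e<..<v + e} - {v}" "{v - e<..<v} \<subseteq> {v - e<..<v + e} - {v}"
    using e(1) by auto
  then have gap: "{v<..<v + e} \<inter> B = {}" "{v - e<..<v} \<inter> B = {}" using e(4) by blast+
  consider "\<sigma> = 1" | "\<sigma> = - 1" using \<sigma> by blast
  then show ?thesis
  proof cases
    case 1
    have "0 \<le> v" "v < v + e" using v e(1) by simp_all
    from affine_offD[OF B(3) this e(3) gap(1)]
    obtain k where k: "\<And>x. x \<in> {v..v + e} \<Longrightarrow> f x = f v + 2 powi k * (x - v)" by metis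
    have "f (v + \<sigma> * t) = f v + \<sigma> * (2 powi k * t)" if "t \<in> {0..e}" for t
      using k[of "v + t"] that 1 by simp
    then show ?thesis using e by (intro that[of "2 powi k" e]) auto
  next
    case 2
    have "v - e < v" "v \<le> 1" using v e(1) by simp_all
    from affine_offD[OF B(3) e(2) this gap(2)]
    obtain k where k: "\<And>x. x \<in> {v - e..v} \<Longrightarrow> f x = f (v - e) + 2 powi k * (x - (v - e))" by metis
    have "f (v + \<sigma> * t) = f v + \<sigma> * (2 powi k * t)" if "t \<in> {0..e}" for t
      using k[of "v - t"] k[of v] that 2 e(1) by (simp add: algebra_simps)
    then show ?thesis using e by (intro that[of "2 powi k" e]) auto
  qed
qed

lemma side_slope_pos:
  assumes "thompson_homeo f" "0 < v" "v < 1" "\<sigma> = 1 \<or> \<sigma> = - 1"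
  shows "side_slope \<sigma> f v > 0"
proof -
  obtain r e where "r > 0" "e > 0" "\<And>t. t \<in> {0..e} \<Longrightarrow> f (v + \<sigma> * t) = f v + \<sigma> * (r * t)"
    using side_slope_exists[OF assms] by metis
  moreover from this have "side_slope \<sigma> f v = r" using assms(4) by (intro side_slope_eqI[of \<sigma> e]) auto
  ultimately show ?thesis by simp
qed

lemma thompson_interior:
  assumes f: "thompson_homeo f" and v: "0 < v" "v < 1"
  shows "0 < f v" "f v < 1"
proof -
  have "f 0 < f v" "f v < f 1" using v by (simp_all add: thompson_less_iff[OF f])
  then show "0 < f v" "f v < 1" by (simp_all add: thompson_ends[OF f])
qed

lemma side_slope_chain:
  assumes f: "thompson_homeo f" and h: "thompson_homeo h" and v: "0 < v" "v < 1" and \<sigma>: "\<sigma> = 1 \<or> \<sigma> = - 1"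
  shows "side_slope \<sigma> (compose {0..1} f h) v = side_slope \<sigma> f (h v) * side_slope \<sigma> h v"
proof -
  note hv = thompson_interior[OF h v]
  obtain r e where r: "r > 0" "e > 0" "0 \<le> v - e" "v + e \<le> 1"
    "\<And>t. t \<in> {0..e} \<Longrightarrow> h (v + \<sigma> * t) = h v + \<sigma> * (r * t)"
    using side_slope_exists[OF h v \<sigma>] by metis
  obtain s d where s: "s > 0" "d > 0"
    "\<And>t. t \<in> {0..d} \<Longrightarrow> f (h v + \<sigma> * t) = f (h v) + \<sigma> * (s * t)"
    using side_slope_exists[OF f hv \<sigma>] by metis
  have \<sigma>0: "\<sigma> \<noteq> 0" using \<sigma> by auto
  have "side_slope \<sigma> (compose {0..1} f h) v = s * r"
  proof (rule side_slope_eqI[OF \<sigma>0])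
    show "0 < min e (d / r)" using r s by simp
    fix t assume t: "t \<in> {0..min e (d / r)}"
    then have "r * t \<in> {0..d}" using r(1) by (auto simp: field_simps)
    moreover have "v + \<sigma> * t \<in> {0..1}" using \<sigma> t r(3,4) by auto
    ultimately show "compose {0..1} f h (v + \<sigma> * t) = compose {0..1} f h v + \<sigma> * (s * r * t)"
      using r(5)[of t] s(3)[of "r * t"] t v by (simp add: compose_def mult.assoc)
  qed
  moreover have "side_slope \<sigma> h v = r" using r \<sigma>0 by (intro side_slope_eqI[of \<sigma> e]) auto
  moreover have "side_slope \<sigma> f (h v) = s" using s \<sigma>0 by (intro side_slope_eqI[of \<sigma> d]) auto
  ultimately show ?thesis by simp
qed

text \<open>
  The cocycle identity. An increasing map does not exchange the two sides of a point, so the chain rule applies on each side.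
\<close>

lemma log_jump_compose:
  assumes f: "thompson_homeo f" and h: "thompson_homeo h" and v: "0 < v" "v < 1"
  shows "log_jump (compose {0..1} f h) v = log_jump f (h v) + log_jump h v"
proof -
  note hv = thompson_interior[OF h v]
  show ?thesis
    using side_slope_pos[OF f hv, of 1] side_slope_pos[OF f hv, of "- 1"]
      side_slope_pos[OF h v, of 1] side_slope_pos[OF h v, of "- 1"]
    by (simp add: log_jump_def side_slope_chain[OF assms] ln_mult)
qed

lemma finite_log_jump_support:
  assumes f: "thompson_homeo f"
  shows "finite {v \<in> {0<..<1}. log_jump f v \<noteq> 0}"
proof -
  obtain B where B: "finite B" "B \<subseteq> dyadic" "affine_off B f" using f by (rule thompson_homeoE)
  have "log_jump f v = 0" if v: "0 < v" "v < 1" "v \<notin> B" for v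
  proof -
    obtain e where e: "e > 0" "0 \<le> v - e" "v + e \<le> 1" "{v - e<..<v + e} \<inter> B \<subseteq> {v}"
      by (rule finite_gap_around[OF B(1) v(1,2)])
    then have "{v - e<..<v + e} \<inter> B = {}" using v(3) by blast
    moreover have "v - e < v + e" using e(1) by simp
    ultimately obtain k where k: "\<And>x. x \<in> {v - e..v + e} \<Longrightarrow> f x = f (v - e) + 2 powi k * (x - (v - e))"
      using affine_offD[OF B(3) e(2) _ e(3)] by metis
    have "side_slope \<sigma> f v = 2 powi k" if \<sigma>: "\<sigma> = 1 \<or> \<sigma> = - 1" for \<sigma>
    proof (rule side_slope_eqI[of \<sigma> e])
      fix t assume "t \<in> {0..e}"
      then have "v + \<sigma> * t \<in> {v - e..v + e}" "v \<in> {v - e..v + e}" using \<sigma> by auto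
      from k[OF this(1)] k[OF this(2)] show "f (v + \<sigma> * t) = f v + \<sigma> * (2 powi k * t)"
        by (simp add: algebra_simps)
    qed (use \<sigma> e in auto)
    then show ?thesis by (simp add: log_jump_def)
  qed
  then have "{v \<in> {0<..<1}. log_jump f v \<noteq> 0} \<subseteq> B" by auto
  then show ?thesis using B(1) by (rule finite_subset)
qed

section \<open>Two contractions of the middle interval\<close>

text \<open>
  Each of the two maps is affine on \<open>[0, 1/4]\<close>, \<open>[1/4, 3/4]\<close> and \<open>[3/4, 1]\<close>, with slopes
  \<open>1, 1/2, 2\<close> and \<open>2, 1/2, 1\<close> respectively; they send \<open>[1/4, 3/4]\<close> onto \<open>[1/4, 1/2]\<close> and
  \<open>[1/2, 3/4]\<close>. Writing them with minima and maxima makes continuity evident.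
\<close>

definition contract_left :: "real \<Rightarrow> real" where
  "contract_left = restrict (\<lambda>x. max (min x (x / 2 + 1 / 8)) (2 * x - 1)) {0..1}"

definition contract_right :: "real \<Rightarrow> real" where
  "contract_right = restrict (\<lambda>x. min (max x (x / 2 + 3 / 8)) (2 * x)) {0..1}"

lemma affine_off_quarters:
  assumes "\<And>x. x \<in> {0..1/4} \<Longrightarrow> f x = c0 + 2 powi k0 * x"
    and "\<And>x. x \<in> {1/4..3/4} \<Longrightarrow> f x = c1 + 2 powi k1 * x"
    and "\<And>x. x \<in> {3/4..1} \<Longrightarrow> f x = c2 + 2 powi k2 * x"
  shows "affine_off {1/4, 3/4} f"
  unfolding affine_off_def
proof (intro allI impI)
  fix a b :: real assume ab: "0 \<le> a \<and> a < b \<and> b \<le> 1 \<and> {a<..<b} \<inter> {1/4, 3/4} = {}"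
  then have "\<not> (a < 1/4 \<and> 1/4 < b)" "\<not> (a < 3/4 \<and> 3/4 < b)" by auto
  then consider "b \<le> 1/4" | "1/4 \<le> a" "b \<le> 3/4" | "3/4 \<le> a" using ab by linarith
  then show "\<exists>k::int. \<forall>x\<in>{a..b}. f x = f a + 2 powi k * (x - a)"
  proof cases
    case 1
    then show ?thesis using ab by (intro exI[of _ k0]) (simp add: assms(1) algebra_simps)
  next
    case 2
    then show ?thesis using ab by (intro exI[of _ k1]) (simp add: assms(2) algebra_simps)
  next
    case 3
    then show ?thesis using ab by (intro exI[of _ k2]) (simp add: assms(3) algebra_simps)
  qed
qed

lemma quarters_dyadic: "{1/4, 3/4} \<subseteq> dyadic"
  using dyadicI[of "1/4" 1 2] dyadicI[of "3/4" 3 2] by auto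

lemma thompson_contract_left: "thompson_homeo contract_left"
proof (rule thompson_homeoI)
  show "continuous_on {0..1} contract_left"
    unfolding contract_left_def
    by (rule continuous_on_eq[of _ "\<lambda>x. max (min x (x / 2 + 1 / 8)) (2 * x - 1)"]) (auto intro!: continuous_intros)
  show "strict_mono_on {0..1} contract_left"
    by (intro strict_mono_onI) (auto simp: contract_left_def max_def min_def)
  show "affine_off {1/4, 3/4} contract_left"
    by (rule affine_off_quarters[of _ 0 0 "1/8" "- 1" "- 1" 1])
      (auto simp: contract_left_def max_def min_def power_int_minus)
qed (use quarters_dyadic in \<open>auto simp: contract_left_def\<close>)

lemma thompson_contract_right: "thompson_homeo contract_right"
proof (rule thompson_homeoI)
  show "continuous_on {0..1} contract_right"
    unfolding contract_right_def
    by (rule continuous_on_eq[of _ "\<lambda>x. min (max x (x / 2 + 3 / 8)) (2 * x)"]) (auto intro!: continuous_intros)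
  show "strict_mono_on {0..1} contract_right"
    by (intro strict_mono_onI) (auto simp: contract_right_def max_def min_def)
  show "affine_off {1/4, 3/4} contract_right"
    by (rule affine_off_quarters[of _ 0 1 "3/8" "- 1" 0 0])
      (auto simp: contract_right_def max_def min_def power_int_minus)
qed (use quarters_dyadic in \<open>auto simp: contract_right_def\<close>)

lemma contract_left_outer: "x \<in> {0..1/4} \<Longrightarrow> contract_left x = x"
  by (auto simp: contract_left_def max_def min_def)

lemma contract_middle:
  assumes "x \<in> {1/4..3/4}"
  shows "contract_left x = x / 2 + 1 / 8" "contract_right x = x / 2 + 3 / 8"
  using assms by (auto simp: contract_left_def contract_right_def max_def min_def)

lemma log_jump_contract_left: "log_jump contract_left (1/4) \<noteq> 0"
proof -
  have "side_slope 1 contract_left (1/4) = 1/2"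
    by (rule side_slope_eqI[of _ "1/8"]) (auto simp: contract_middle field_simps)
  moreover have "side_slope (- 1) contract_left (1/4) = 1"
    by (rule side_slope_eqI[of _ "1/8"]) (simp_all add: contract_left_outer)
  ultimately show ?thesis by (simp add: log_jump_def ln_div)
qed

text \<open>
  In the coordinate on \<open>[1/4, 3/4]\<close> that runs from \<open>0\<close> to \<open>1\<close>, these are the fractions
  \<open>(2 * j + 1) / 2 ^ Suc k\<close>. The two contractions halve the coordinate and, for the right one, add \<open>1/2\<close>, so they map level
  \<open>k\<close> to the lower and the upper half of level \<open>Suc k\<close>.
\<close>

definition middle_point :: "nat \<Rightarrow> nat \<Rightarrow> real" where
  "middle_point k j = 1/4 + (2 * real j + 1) / 2 ^ (k + 2)"

lemma middle_point_range:
  assumes "j < 2 ^ k"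
  shows "1/4 \<le> middle_point k j" "middle_point k j \<le> 3/4"
proof -
  have "real j + 1 \<le> 2 ^ k" using assms by (metis Suc_leI of_nat_1 of_nat_Suc of_nat_le_iff of_nat_numeral of_nat_power add.commute)
  then show "middle_point k j \<le> 3/4" by (simp add: middle_point_def field_simps)
  show "1/4 \<le> middle_point k j" by (simp add: middle_point_def)
qed

lemma middle_point_contract:
  assumes "j < 2 ^ k"
  shows "middle_point (Suc k) j = contract_left (middle_point k j)"
    and "middle_point (Suc k) (j + 2 ^ k) = contract_right (middle_point k j)"
proof -
  have "middle_point k j \<in> {1/4..3/4}" using middle_point_range[OF assms] by simp
  note c = contract_middle[OF this]
  show "middle_point (Suc k) j = contract_left (middle_point k j)"
    unfolding c by (simp add: middle_point_def field_simps)
  show "middle_point (Suc k) (j + 2 ^ k) = contract_right (middle_point k j)"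
    unfolding c by (simp add: middle_point_def field_simps)
qed

lemma inj_middle_point: "inj (middle_point k)"
  by (rule injI) (simp add: middle_point_def)

section \<open>The Poisson boundary of Thompson's group\<close>

theorem corollary1p3:
  fixes \<mu> :: "(real \<Rightarrow> real) measure"
  assumes "prob_space \<mu>"
    and "sets \<mu> = Pow (carrier thompson_F)"
    and "finite_first_moment thompson_F \<mu>"
    and "semigroup_generate thompson_F (supp \<mu>) = carrier thompson_F"
  shows "poisson_boundary_nontrivial thompson_F \<mu>"
proof -
  interpret \<mu>: prob_space \<mu> by fact
  interpret F: group thompson_F by (rule group_thompson)
  have space: "space \<mu> = carrier thompson_F"
    using sets_eq_imp_space_eq[of \<mu> "count_space (carrier thompson_F)"] assms(2) by simp
  have countable: "countable (carrier thompson_F)"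
  proof -
    have "countable (supp \<mu>)"
      by (rule countable_subset[OF _ \<mu>.countable_support]) (auto simp: supp_def)
    then have "countable (semigroup_generate thompson_F (supp \<mu>))"
      by (intro F.countable_semigroup_generate) (auto simp: supp_def space)
    then show ?thesis by (simp only: assms(4))
  qed
  \<comment> \<open>All of the argument takes place on the orbit of the root of the binary tree.\<close>
  define X where "X = (\<lambda>g. g (1/2)) ` carrier thompson_F"
  have X: "0 < v" "v < 1" if "v \<in> X" for v
    using that thompson_interior[of _ "1/2"] by (auto simp: X_def carrier_thompson)
  have mult: "g \<otimes>\<^bsub>thompson_F\<^esub> h = compose {0..1} g h"
    if "g \<in> carrier thompson_F" "h \<in> carrier thompson_F" for g h
    using that by (simp add: carrier_thompson thompson_mult)
  have act: "(g \<otimes>\<^bsub>thompson_F\<^esub> h) v = g (h v)"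
    if "g \<in> carrier thompson_F" "h \<in> carrier thompson_F" "v \<in> {0..1}" for g h v
    using that by (simp add: mult compose_def)
  \<comment> \<open>Points of \<open>X\<close> lie in the unit interval, where the restrictions in the unit and the product of the group are invisible.\<close>
  interpret F: random_action thompson_F \<mu> X "\<lambda>g v. g v"
  proof
    fix g v assume g: "g \<in> carrier thompson_F" and "v \<in> X"
    then obtain h where "h \<in> carrier thompson_F" "v = h (1/2)" by (auto simp: X_def)
    then show "g v \<in> X"
      using g act[of g h "1/2"] unfolding X_def by (intro image_eqI[of _ _ "g \<otimes>\<^bsub>thompson_F\<^esub> h"]) auto
  qed (use X assms(2) countable act in \<open>auto simp: thompson_one X_def less_imp_le\<close>)
  have gen: "g \<in> semigroup_generate thompson_F (supp \<mu>)" if "thompson_homeo g" for g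
    using that by (simp add: assms(4) carrier_thompson)
  have half: "middle_point 0 0 = 1/2" by (simp add: middle_point_def)
  have "restrict (\<lambda>x. x) {0..1} (1/2 :: real) \<in> X"
    using imageI[OF CollectI[of thompson_homeo, OF thompson_homeo_id], of "\<lambda>g. g (1/2)"]
    unfolding X_def carrier_thompson .
  then have half_X: "1/2 \<in> X" by simp
  have middle_X: "middle_point k j \<in> X" if "j < 2 ^ k" for k j
    using that
  proof (induction k arbitrary: j)
    case 0
    then show ?case using half_X by (simp add: half)
  next
    case (Suc k)
    show ?case
    proof (cases "j < 2 ^ k")
      case True
      then show ?thesis
        using Suc.IH F.act_closed[of contract_left] thompson_contract_left
        by (simp add: middle_point_contract carrier_thompson)
    next
      case False
      then have "middle_point (Suc k) j = contract_right (middle_point k (j - 2 ^ k))"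
        using middle_point_contract(2)[of "j - 2 ^ k" k] Suc.prems by simp
      moreover have "j - 2 ^ k < 2 ^ k" using False Suc.prems by simp
      ultimately show ?thesis
        using Suc.IH F.act_closed[of contract_right] thompson_contract_right
        by (simp add: carrier_thompson)
    qed
  qed
  obtain K where K: "\<And>n v. v \<in> X \<Longrightarrow> F.occupation (1/2) n v \<le> ennreal K"
    using F.occupation_bounded[where p = middle_point, OF gen[OF thompson_contract_left] gen[OF thompson_contract_right]
        middle_X inj_on_subset[OF inj_middle_point subset_UNIV] middle_point_contract]
    unfolding half by blast
  have cocycle: "log_jump (g \<otimes>\<^bsub>thompson_F\<^esub> h) v = log_jump g (h v) + log_jump h v"
    if "g \<in> carrier thompson_F" "h \<in> carrier thompson_F" "v \<in> X" for g h v
    using that X[of v] by (simp add: mult carrier_thompson log_jump_compose)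
  have "finite {v \<in> X. log_jump g v \<noteq> 0}" if "g \<in> carrier thompson_F" for g
    using that X by (intro finite_subset[OF _ finite_log_jump_support[of g]]) (auto simp: carrier_thompson)
  then have moment: "(\<integral>\<^sup>+ g. (\<integral>\<^sup>+ v. ennreal \<bar>log_jump g v\<bar> \<partial>count_space X) \<partial>\<mu>) < \<infinity>"
    by (intro F.cocycle_moment[OF assms(3)] cocycle)
  show ?thesis
  proof (rule F.poisson_boundary_nontrivial_if_limit)
    show "AE y in F.increments. convergent (\<lambda>n. log_jump (walk thompson_F y n) (1/2))"
      by (rule F.cocycle_converges[where C = log_jump and K = K]) (fact half_X cocycle K moment)+
  next
    fix c
    \<comment> \<open>\<open>1/4\<close> lies in the orbit, and \<open>contract_left\<close> fixes it with slope \<open>1\<close> on the left and \<open>1/2\<close> on the right.\<close>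
    have "contract_right (1/4) = 1/2" by (simp add: contract_middle)
    moreover have "thompson_inverse contract_right (contract_right (1/4)) = 1/4"
      by (rule thompson_inverse_eq(2)[OF thompson_contract_right]) simp
    ultimately have quarter: "thompson_inverse contract_right (1/2) = 1/4" by (simp only:)
    show "\<not> (AE y in F.increments. (\<lambda>n. log_jump (walk thompson_F y n) (1/2)) \<longlonglongrightarrow> c)"
    proof (rule F.limit_not_constant[where C = log_jump and s = "thompson_inverse contract_right" and a = contract_left])
      show "contract_left (thompson_inverse contract_right (1/2)) = thompson_inverse contract_right (1/2)"
        unfolding quarter by (simp add: contract_left_outer)
      show "log_jump contract_left (thompson_inverse contract_right (1/2)) \<noteq> 0"
        unfolding quarter by (rule log_jump_contract_left)
    qed (fact cocycle half_X gen[OF thompson_homeo_inverse[OF thompson_contract_right]] gen[OF thompson_contract_left])+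
  qed
qed

end
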